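(* There is an absolute constant $C>0$ such that the following holds. Let $m\ge0$, $T>0$, and let $\Phi$ and $\Psi$ be solutions of the free Dirac equation $i\partial_t\Phi=(\alpha\cdot D+m\beta)\Phi$ (respectively for $\Psi$) with the same mass $m$ and Schwartz initial data on $\mathbb{R}^3$. Then $$\int_0^T\!\!\int_{\mathbb{R}}\Big(e(U_\Phi)\,e(V_\Psi)+e(V_\Phi)\,e(U_\Psi)\Big)\,dx_1\,dt\le C\,\|\Psi(0)\|_{L^2_x}^2\Big(\|\Phi(0)\|_{L^2_x}^2+\int_0^T\!\!\int_{\mathbb{R}^3}|D_{y,m}V_\Phi|\,|U_\Phi|\,dx\,dt\Big).$$
   Context: Let $\gamma^0=\begin{pmatrix}I_2&0\\0&-I_2\end{pmatrix}$, $\gamma^j=\begin{pmatrix}0&\sigma^j\\-\sigma^j&0\end{pmatrix}$, $j=1,2,3$, with Pauli matrices $\sigma^1=\begin{pmatrix}0&1\\1&0\end{pmatrix}$, $\sigma^2=\begin{pmatrix}0&-i\\i&0\end{pmatrix}$, $\sigma^3=\begin{pmatrix}1&0\\0&-1\end{pmatrix}$; $\beta=\gamma^0$, $\alpha^j=\gamma^0\gamma^j$, $D=-i\nabla$, $\alpha\cdot D=\sum_j\alpha^jD_j$. For a spinor field $\Phi=(\phi_1,\phi_2,\phi_3,\phi_4)^T:\mathbb{R}^{1+3}\to\mathbb{C}^4$ define the two-component fields $$U_\Phi=\begin{pmatrix}\phi_1+\phi_4\\\phi_2+\phi_3\end{pmatrix},\qquad V_\Phi=\begin{pmatrix}\phi_1-\phi_4\\\phi_2-\phi_3\end{pmatrix}.$$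 Write $x=(x_1,y)$ with $y=(x_2,x_3)$. The transverse Dirac operator is $$D_y=\begin{pmatrix}i\partial_2&-\partial_3\\\partial_3&-i\partial_2\end{pmatrix},\qquad D_{y,m}:=D_y+imI_2 .$$ For a two-component field $W=W(t,x_1,y)$, its transverse density is $e(W)(t,x_1):=\int_{\mathbb{R}^2}|W(t,x_1,y)|^2\,dy$. *)

theory Defs
  imports "HOL-Analysis.Analysis"
begin

text \<open>Space is \<^typ>\<open>real^3\<close> and spinors are \<^typ>\<open>complex^4\<close>, so \<^const>\<open>norm\<close> is the Euclidean
  (Hermitian) norm. A field on space-time is a curried function of time and position.\<close>

definition pauli :: "3 \<Rightarrow> complex^2^2" where
  "pauli j =
    (if j = 1 then vector [vector [0, 1], vector [1, 0]]
     else if j = 2 then vector [vector [0, - \<i>], vector [\<i>, 0]]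
     else vector [vector [1, 0], vector [0, -1]])"

definition block_mat :: "complex^2^2 \<Rightarrow> complex^2^2 \<Rightarrow> complex^2^2 \<Rightarrow> complex^2^2 \<Rightarrow> complex^4^4" where
  "block_mat A B C D = vector
    [vector [A$1$1, A$1$2, B$1$1, B$1$2],
     vector [A$2$1, A$2$2, B$2$1, B$2$2],
     vector [C$1$1, C$1$2, D$1$1, D$1$2],
     vector [C$2$1, C$2$2, D$2$1, D$2$2]]"

definition gamma0 :: "complex^4^4" where
  "gamma0 = block_mat (mat 1) 0 0 (- mat 1)"

definition gamma :: "3 \<Rightarrow> complex^4^4" where
  "gamma j = block_mat 0 (pauli j) (- pauli j) 0"

definition beta :: "complex^4^4" where
  "beta = gamma0"

definition alpha :: "3 \<Rightarrow> complex^4^4" where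
  "alpha j = gamma0 ** gamma j"

definition pderiv_at :: "'n::finite \<Rightarrow> (real^'n \<Rightarrow> 'b::real_normed_vector) \<Rightarrow> real^'n \<Rightarrow> 'b" where
  "pderiv_at j f x = vector_derivative (\<lambda>s. f (x + s *\<^sub>R axis j 1)) (at 0)"

text \<open>Iterated partial derivatives; a list of directions plays the role of a multi-index.\<close>

definition pderivs :: "'n::finite list \<Rightarrow> (real^'n \<Rightarrow> 'b::real_normed_vector) \<Rightarrow> real^'n \<Rightarrow> 'b" where
  "pderivs js f = foldr pderiv_at js f"

text \<open>The first conjunct is smoothness: if all iterated partial derivatives are (Frechet)
  differentiable, then all of them are continuous, and conversely.\<close>

definition schwartz :: "(real^'n::finite \<Rightarrow> 'b::real_normed_vector) \<Rightarrow> bool" where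
  "schwartz f \<longleftrightarrow>
    (\<forall>js x. pderivs js f differentiable (at x)) \<and>
    (\<forall>js (k::nat). \<exists>B. \<forall>x. norm x ^ k * norm (pderivs js f x) \<le> B)"

definition C1_field :: "(real \<Rightarrow> real^3 \<Rightarrow> complex^4) \<Rightarrow> bool" where
  "C1_field \<Phi> \<longleftrightarrow>
    (\<exists>\<Phi>' :: real \<times> (real^3) \<Rightarrow> (real \<times> (real^3)) \<Rightarrow>\<^sub>L (complex^4).
      (\<forall>p. ((\<lambda>(t, x). \<Phi> t x) has_derivative blinfun_apply (\<Phi>' p)) (at p)) \<and>
      continuous_on UNIV \<Phi>')"

definition alpha_D :: "(real^3 \<Rightarrow> complex^4) \<Rightarrow> real^3 \<Rightarrow> complex^4" where
  "alpha_D f x = (\<Sum>j\<in>UNIV. alpha j *v ((- \<i>) *s pderiv_at j f x))"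

text \<open>Global classical solutions of the free Dirac equation of mass \<open>m\<close>. For Schwartz data at
  time 0 there is exactly one such solution.\<close>

definition dirac_solution :: "real \<Rightarrow> (real \<Rightarrow> real^3 \<Rightarrow> complex^4) \<Rightarrow> bool" where
  "dirac_solution m \<Phi> \<longleftrightarrow> C1_field \<Phi> \<and>
    (\<forall>t x. \<i> *s vector_derivative (\<lambda>s. \<Phi> s x) (at t)
         = alpha_D (\<Phi> t) x + complex_of_real m *s (beta *v \<Phi> t x))"

definition U_comp :: "(real \<Rightarrow> real^3 \<Rightarrow> complex^4) \<Rightarrow> real \<Rightarrow> real^3 \<Rightarrow> complex^2" where
  "U_comp \<Phi> t x = vector [\<Phi> t x $ 1 + \<Phi> t x $ 4, \<Phi> t x $ 2 + \<Phi> t x $ 3]"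

definition V_comp :: "(real \<Rightarrow> real^3 \<Rightarrow> complex^4) \<Rightarrow> real \<Rightarrow> real^3 \<Rightarrow> complex^2" where
  "V_comp \<Phi> t x = vector [\<Phi> t x $ 1 - \<Phi> t x $ 4, \<Phi> t x $ 2 - \<Phi> t x $ 3]"

definition D_y :: "(real^3 \<Rightarrow> complex^2) \<Rightarrow> real^3 \<Rightarrow> complex^2" where
  "D_y w x = vector
    [\<i> * pderiv_at 2 w x $ 1 - pderiv_at 3 w x $ 2,
     pderiv_at 3 w x $ 1 - \<i> * pderiv_at 2 w x $ 2]"

definition D_ym :: "real \<Rightarrow> (real^3 \<Rightarrow> complex^2) \<Rightarrow> real^3 \<Rightarrow> complex^2" where
  "D_ym m w x = D_y w x + (\<i> * complex_of_real m) *s w x"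

text \<open>All integrands below are nonnegative, so the integrals are taken with values in
  \<^typ>\<open>ennreal\<close>, without integrability side conditions.\<close>

definition trans_density :: "(real \<Rightarrow> real^3 \<Rightarrow> complex^2) \<Rightarrow> real \<Rightarrow> real \<Rightarrow> ennreal" where
  "trans_density W t x1 =
    (\<integral>\<^sup>+ y. ennreal ((norm (W t (vector [x1, y $ 1, y $ 2])))\<^sup>2) \<partial>(lborel :: (real^2) measure))"

definition L2_norm_sq :: "(real^3 \<Rightarrow> complex^4) \<Rightarrow> ennreal" where
  "L2_norm_sq f = (\<integral>\<^sup>+ x. ennreal ((norm (f x))\<^sup>2) \<partial>lborel)"

end

theory Submission imports Defs begin

text \<open>Along characteristics, \<open>(\<partial>\<^sub>t + \<partial>\<^sub>1) U = - D\<^sub>y\<^sub>,\<^sub>m V\<close> and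
  \<open>(\<partial>\<^sub>t - \<partial>\<^sub>1) V\<close> is the adjoint operator applied to \<open>U\<close>. Hence the transverse density of
  \<open>U\<^sub>\<Phi>\<close> along \<open>x\<^sub>1 = z + t\<close>, and that of \<open>V\<^sub>\<Phi>\<close> along \<open>x\<^sub>1 = z - t\<close>, exceeds its initial value by
  at most \<open>2 \<integral> |D\<^sub>y\<^sub>,\<^sub>m V| |U|\<close> over that null plane, a bound that no longer depends on \<open>t\<close>.
  On the other hand, the conservation of charge in the region beyond the null plane \<open>x\<^sub>1 = z + t\<close> bounds
  the flux through it, which is the time integral of the density of \<open>V\<^sub>\<Psi>\<close>, by \<open>\<parallel>\<Psi>(0)\<parallel>\<^sup>2\<close>; the same
  holds for \<open>U\<^sub>\<Psi>\<close> and \<open>x\<^sub>1 = z - t\<close>. Multiplying and integrating over \<open>z\<close> gives the estimate.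
  All integrations by parts are done against a cutoff supported in a backward cone, so no decay of
  the solutions at positive times is needed.\<close>

section \<open>Directional derivatives of continuously differentiable functions\<close>

text \<open>The two transport laws are not symmetric. Giving |U|^2 and |V|^2 the same source, up to
  sign, means moving the transverse derivatives from U to V in the second law, and this costs a
  transverse current. The cutoff turns that current into an error: its |V|^2 share is absorbed by
  the time derivative of the cutoff, while the |U|^2 share survives as 8/R times the integral of
  |U|^2 over the plane x1 = z - t. Hence the flux bound is needed for \<Phi> itself, not only for
  \<Psi>, and the finite charge of \<Phi> enters exactly there. Integrals take values in
  \<open>ennreal\<close> and the cutoff is removed by Fatou's lemma, which suits one-sided bounds
  with no integrability known in advance. The constant 4: each of the two families of null planes
  contributes twice the pairing integral, and the two initial densities of \<Phi> add up to twice
  its charge, because |a + b|^2 + |a - b|^2 = 2 (|a|^2 + |b|^2).\<close>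

definition C1_fun :: "('a::real_normed_vector \<Rightarrow> 'b::real_normed_vector) \<Rightarrow> bool" where
  "C1_fun f \<longleftrightarrow> (\<forall>p. f differentiable (at p)) \<and>
     (\<forall>v. continuous_on UNIV (\<lambda>p. frechet_derivative f (at p) v))"

text \<open>On space-time a direction is a pair (time part, space part):
  \<open>(1, \<tau> *\<^sub>R e1)\<close> with \<tau> = 1 or -1 points along a null ray, and
  \<open>(0, e2)\<close>, \<open>(0, e3)\<close> are the transverse directions.\<close>

definition dir_deriv :: "'a::real_normed_vector \<Rightarrow> ('a \<Rightarrow> 'b::real_normed_vector) \<Rightarrow> 'a \<Rightarrow> 'b" where
  "dir_deriv v f p = frechet_derivative f (at p) v"

lemma C1_fun_has_derivative:
  assumes "C1_fun f"
  shows "(f has_derivative (\<lambda>v. dir_deriv v f p)) (at p)"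
  using assms unfolding C1_fun_def dir_deriv_def by (simp add: frechet_derivative_works)

text \<open>Continuity is asked for one fixed direction at a time, so sums, products and linear
  images are handled by the ordinary continuity rules, with no operator-valued derivative.\<close>

lemma C1_funI:
  assumes "\<And>p. (f has_derivative (\<lambda>v. f' v p)) (at p)"
    and "\<And>v. continuous_on UNIV (f' v)"
  shows "C1_fun f" and "dir_deriv v f p = f' v p"
proof -
  have eq: "frechet_derivative f (at p) = (\<lambda>v. f' v p)" for p
    using frechet_derivative_at[OF assms(1)] by simp
  show "C1_fun f"
    unfolding C1_fun_def eq using assms by (auto simp: differentiable_def)
  show "dir_deriv v f p = f' v p" by (simp add: dir_deriv_def eq)
qed

lemma continuous_on_dir_deriv:
  assumes "C1_fun f" "continuous_on S g"
  shows "continuous_on S (\<lambda>x. dir_deriv v f (g x))"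
proof -
  have "continuous_on UNIV (dir_deriv v f)"
    using assms(1) unfolding C1_fun_def dir_deriv_def by auto
  then show ?thesis using assms(2) by (rule continuous_on_compose2) auto
qed

lemma continuous_on_C1_fun:
  assumes "C1_fun f" "continuous_on S g"
  shows "continuous_on S (\<lambda>x. f (g x))"
proof -
  have "continuous_on UNIV f"
    using assms(1) unfolding C1_fun_def
    by (intro continuous_at_imp_continuous_on) (auto intro: differentiable_imp_continuous_within)
  then show ?thesis using assms(2) by (rule continuous_on_compose2) auto
qed

lemma dir_deriv_sum_scale:
  assumes "C1_fun f"
  shows "dir_deriv (a *\<^sub>R v + b *\<^sub>R w) f p = a *\<^sub>R dir_deriv v f p + b *\<^sub>R dir_deriv w f p"
proof -
  have "linear (\<lambda>v. dir_deriv v f p)"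
    using C1_fun_has_derivative[OF assms] by (rule has_derivative_linear)
  then show ?thesis by (simp add: linear_add[of "\<lambda>v. dir_deriv v f p"] linear_scale[of "\<lambda>v. dir_deriv v f p"])
qed

lemma dir_deriv_line:
  assumes "C1_fun f"
  shows "((\<lambda>s. f (p + s *\<^sub>R v)) has_vector_derivative dir_deriv v f (p + s *\<^sub>R v)) (at s)"
proof -
  have lin: "linear (\<lambda>v. dir_deriv v f (p + s *\<^sub>R v'))" for v'
    using C1_fun_has_derivative[OF assms] by (rule has_derivative_linear)
  have "((\<lambda>s. p + s *\<^sub>R v) has_derivative (\<lambda>h. h *\<^sub>R v)) (at s)"
    by (auto intro!: derivative_eq_intros)
  from diff_chain_at[OF this C1_fun_has_derivative[OF assms]] show ?thesis
    unfolding has_vector_derivative_def o_def by (simp add: linear_scale[OF lin])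
qed

lemma C1_fun_bounded_bilinear:
  assumes "bounded_bilinear B" "C1_fun f" "C1_fun g"
  shows "C1_fun (\<lambda>p. B (f p) (g p))"
    and "dir_deriv v (\<lambda>p. B (f p) (g p)) p = B (f p) (dir_deriv v g p) + B (dir_deriv v f p) (g p)"
proof -
  let ?D = "\<lambda>v p. B (f p) (dir_deriv v g p) + B (dir_deriv v f p) (g p)"
  have 1: "((\<lambda>p. B (f p) (g p)) has_derivative (\<lambda>v. ?D v p)) (at p)" for p
    by (rule bounded_bilinear.FDERIV[OF assms(1)]) (intro C1_fun_has_derivative assms)+
  have 2: "continuous_on UNIV (?D v)" for v
    using assms
    by (intro continuous_on_add bounded_bilinear.continuous_on[OF assms(1)]
        continuous_on_dir_deriv continuous_on_C1_fun[OF assms(2)] continuous_on_C1_fun[OF assms(3)] continuous_on_id)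
  show "C1_fun (\<lambda>p. B (f p) (g p))" "dir_deriv v (\<lambda>p. B (f p) (g p)) p = ?D v p"
    using C1_funI[OF 1 2] by auto
qed

lemma C1_fun_bounded_linear:
  assumes "bounded_linear L" "C1_fun f"
  shows "C1_fun (\<lambda>p. L (f p))" and "dir_deriv v (\<lambda>p. L (f p)) p = L (dir_deriv v f p)"
proof -
  have 1: "((\<lambda>p. L (f p)) has_derivative (\<lambda>v. L (dir_deriv v f p))) (at p)" for p
    by (rule bounded_linear.has_derivative[OF assms(1) C1_fun_has_derivative[OF assms(2)]])
  have 2: "continuous_on UNIV (\<lambda>p. L (dir_deriv v f p))" for v
    using assms by (intro bounded_linear.continuous_on[OF assms(1)] continuous_on_dir_deriv continuous_on_id)
  show "C1_fun (\<lambda>p. L (f p))" "dir_deriv v (\<lambda>p. L (f p)) p = L (dir_deriv v f p)"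
    using C1_funI[OF 1 2] by auto
qed

lemma C1_fun_add:
  assumes "C1_fun f" "C1_fun g"
  shows "C1_fun (\<lambda>p. f p + g p)" and "dir_deriv v (\<lambda>p. f p + g p) p = dir_deriv v f p + dir_deriv v g p"
proof -
  have 1: "((\<lambda>p. f p + g p) has_derivative (\<lambda>v. dir_deriv v f p + dir_deriv v g p)) (at p)" for p
    by (intro has_derivative_add C1_fun_has_derivative assms)
  have 2: "continuous_on UNIV (\<lambda>p. dir_deriv v f p + dir_deriv v g p)" for v
    using assms by (intro continuous_on_add continuous_on_dir_deriv continuous_on_id)
  show "C1_fun (\<lambda>p. f p + g p)" "dir_deriv v (\<lambda>p. f p + g p) p = dir_deriv v f p + dir_deriv v g p"
    using C1_funI[OF 1 2] by auto
qed

lemmas C1_fun_mult = C1_fun_bounded_bilinear[OF bounded_bilinear_mult]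
lemmas C1_fun_inner = C1_fun_bounded_bilinear[OF bounded_bilinear_inner]

text \<open>In the applications \<open>L\<close> parametrises a transverse slice of space-time by y,
  and the slice is carried along \<open>v\<close>. The box is compact and does not move, so the
  Leibniz rule needs continuity only.\<close>

lemma has_real_derivative_integral_line:
  fixes g :: "'a::real_normed_vector \<Rightarrow> real" and L :: "'b::euclidean_space \<Rightarrow> 'a"
  assumes g: "C1_fun g" and L: "continuous_on UNIV L"
  shows "((\<lambda>s. integral (cbox a b) (\<lambda>y. g (L y + s *\<^sub>R v))) has_real_derivative
           integral (cbox a b) (\<lambda>y. dir_deriv v g (L y + s0 *\<^sub>R v))) (at s0)"
proof -
  have L': "continuous_on S (\<lambda>x. L (h x))" if "continuous_on S h" for S :: "'c::topological_space set" and h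
    using L that by (rule continuous_on_compose2) auto
  show ?thesis
  proof (rule leibniz_rule_field_derivative[where U = UNIV])
    show "((\<lambda>s. g (L y + s *\<^sub>R v)) has_real_derivative dir_deriv v g (L y + s *\<^sub>R v)) (at s)" for s y
      using dir_deriv_line[OF g, of "L y" v s] by (simp add: has_real_derivative_iff_has_vector_derivative)
    show "(\<lambda>y. g (L y + s *\<^sub>R v)) integrable_on cbox a b" for s
      by (intro integrable_continuous continuous_on_C1_fun[OF g] continuous_intros L')
    show "continuous_on (UNIV \<times> cbox a b) (\<lambda>(s, y). dir_deriv v g (L y + s *\<^sub>R v))"
      unfolding case_prod_beta
      by (intro continuous_on_dir_deriv[OF g] continuous_intros L')
  qed auto
qed

text \<open>The integral over translates of a compactly supported function is constant, and its
  derivative is the integral of the directional derivative.\<close>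

lemma integral_dir_deriv_eq_0:
  fixes g :: "'a::real_normed_vector \<Rightarrow> real" and L :: "'b::euclidean_space \<Rightarrow> 'a"
  assumes g: "C1_fun g" and L: "continuous_on UNIV L"
    and shift: "\<And>y s. L (y + s *\<^sub>R w) = L y + s *\<^sub>R v"
    and supp: "\<And>y s. \<bar>s\<bar> < 1 \<Longrightarrow> g (L y + s *\<^sub>R v) \<noteq> 0 \<Longrightarrow> y \<in> cbox a b"
  shows "integral (cbox a b) (\<lambda>y. dir_deriv v g (L y)) = 0"
proof -
  define F where "F s = integral (cbox a b) (\<lambda>y. g (L y + s *\<^sub>R v))" for s
  \<comment> \<open>Shifting y by \<open>s *\<^sub>R w\<close> moves the argument of
    \<open>g\<close> by \<open>s *\<^sub>R v\<close>. The integrand vanishes outside the shifted box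
    and outside the original one, so both integrals equal the one over the whole space.\<close>
  have const: "F s = F 0" if "\<bar>s\<bar> < 1" for s
  proof -
    have "continuous_on (cbox a b) (\<lambda>y. g (L y))"
      by (intro continuous_on_C1_fun[OF g] continuous_on_subset[OF L]) auto
    then have "((\<lambda>y. g (L y)) has_integral F 0) (cbox a b)"
      by (simp add: F_def integrable_continuous integrable_integral)
    from has_integral_shift_cbox[OF this, of "s *\<^sub>R w"]
    have "((\<lambda>y. g (L y + s *\<^sub>R v)) has_integral F 0) (cbox (a - s *\<^sub>R w) (b - s *\<^sub>R w))"
      by (simp add: shift)
    moreover have "g (L y + s *\<^sub>R v) = 0" if "y \<notin> cbox (a - s *\<^sub>R w) (b - s *\<^sub>R w)" for y
    proof -
      have "y + s *\<^sub>R w \<notin> cbox a b"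
        using that by (auto simp: mem_box inner_diff_left inner_add_left algebra_simps)
      then show ?thesis using supp[of 0 "y + s *\<^sub>R w"] by (auto simp: shift)
    qed
    ultimately have "((\<lambda>y. g (L y + s *\<^sub>R v)) has_integral F 0) UNIV"
      by (rule has_integral_on_superset) auto
    moreover have "((\<lambda>y. g (L y + s *\<^sub>R v)) has_integral F s) (cbox a b)"
      unfolding F_def
      by (intro integrable_integral integrable_continuous continuous_on_C1_fun[OF g]
          continuous_intros continuous_on_subset[OF L]) auto
    then have "((\<lambda>y. g (L y + s *\<^sub>R v)) has_integral F s) UNIV"
      by (rule has_integral_on_superset) (use supp that in auto)
    ultimately show ?thesis by (rule has_integral_unique[symmetric])
  qed
  have "(F has_real_derivative integral (cbox a b) (\<lambda>y. dir_deriv v g (L y))) (at 0)"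
    unfolding F_def using has_real_derivative_integral_line[OF g L, of a b v 0] by simp
  moreover have "(F has_real_derivative 0) (at 0)"
  proof -
    have "\<forall>\<^sub>F s in nhds 0. s \<in> {-1<..<1::real}" by (rule eventually_nhds_in_open) auto
    then have ev: "\<forall>\<^sub>F s in nhds 0. F 0 = F s"
      by eventually_elim (rule const[symmetric], simp add: abs_less_iff)
    show ?thesis using DERIV_cong_ev[OF refl ev refl] DERIV_const by blast
  qed
  ultimately show ?thesis by (rule DERIV_unique)
qed

section \<open>A cutoff on a backward cone\<close>

text \<open>The slope 3 of the cone makes the time derivative of the cutoff dominate the currents,
  whose components in the three coordinate directions are each at most the total density.\<close>

definition cutoff :: "real \<Rightarrow> real \<times> (real^3) \<Rightarrow> real" where
  "cutoff R p = (max 0 ((R - 3 * fst p)\<^sup>2 - snd p \<bullet> snd p))\<^sup>2 / R ^ 4"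

text \<open>Squaring removes the corner of the positive part: at 0 the difference quotient is at
  most |h|. This makes the cutoff continuously differentiable across the surface of its
  cone.\<close>

lemma has_real_derivative_max0_sq:
  "((\<lambda>u::real. (max 0 u)\<^sup>2) has_real_derivative 2 * max 0 u) (at u)"
proof (cases "u = 0")
  case True
  have "((\<lambda>h::real. (max 0 h)\<^sup>2 / h) \<longlongrightarrow> 0) (at 0)"
  proof (rule Lim_null_comparison[where g = "\<lambda>h. \<bar>h\<bar>"])
    show "\<forall>\<^sub>F h in at 0. norm ((max 0 h)\<^sup>2 / h) \<le> \<bar>h::real\<bar>"
      by (intro always_eventually) (auto simp: max_def power2_eq_square)
  qed (auto intro!: tendsto_eq_intros)
  then show ?thesis using True by (simp add: has_field_derivative_iff)
next
  case False
  show ?thesis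
  proof (cases "u > 0")
    case True
    have "\<forall>\<^sub>F s in nhds u. s \<in> {0<..}"
      using True by (intro eventually_nhds_in_open) auto
    then have ev: "\<forall>\<^sub>F s in nhds u. s\<^sup>2 = (max 0 s)\<^sup>2" by eventually_elim auto
    have "((\<lambda>u::real. u\<^sup>2) has_real_derivative 2 * u) (at u)"
      by (auto intro!: derivative_eq_intros)
    with DERIV_cong_ev[OF refl ev refl] True show ?thesis by simp
  next
    case u: False
    have "\<forall>\<^sub>F s in nhds u. s \<in> {..<0}"
      using False u by (intro eventually_nhds_in_open) auto
    then have ev: "\<forall>\<^sub>F s in nhds u. 0 = (max 0 s)\<^sup>2" by eventually_elim auto
    have "((\<lambda>u::real. 0::real) has_real_derivative 0) (at u)" by simp
    with DERIV_cong_ev[OF refl ev refl] u show ?thesis by simp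
  qed
qed

lemma C1_fun_cutoff:
  shows "C1_fun (cutoff R)"
    and "dir_deriv v (cutoff R) p =
      - (4 * max 0 ((R - 3 * fst p)\<^sup>2 - snd p \<bullet> snd p) / R ^ 4) * (3 * (R - 3 * fst p) * fst v + snd p \<bullet> snd v)"
proof -
  let ?u = "\<lambda>p::real \<times> (real^3). (R - 3 * fst p)\<^sup>2 - snd p \<bullet> snd p"
  let ?D = "\<lambda>v p. - (4 * max 0 (?u p) / R ^ 4) * (3 * (R - 3 * fst p) * fst v + snd p \<bullet> snd v)"
  have 1: "(cutoff R has_derivative (\<lambda>v. ?D v p)) (at p)" for p
  proof -
    have "(?u has_derivative (\<lambda>v. - 2 * (3 * (R - 3 * fst p) * fst v + snd p \<bullet> snd v))) (at p)"
      by (auto intro!: derivative_eq_intros simp: algebra_simps inner_commute)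
    from diff_chain_at[OF this has_real_derivative_max0_sq[unfolded has_field_derivative_def]]
    have "((\<lambda>p. (max 0 (?u p))\<^sup>2) has_derivative
        (\<lambda>v. 2 * max 0 (?u p) * (- 2 * (3 * (R - 3 * fst p) * fst v + snd p \<bullet> snd v)))) (at p)"
      by (simp add: o_def)
    then have "((\<lambda>p. (max 0 (?u p))\<^sup>2 * (1 / R ^ 4)) has_derivative
        (\<lambda>v. (2 * max 0 (?u p) * (- 2 * (3 * (R - 3 * fst p) * fst v + snd p \<bullet> snd v))) * (1 / R^4))) (at p)"
      by (rule has_derivative_mult_left)
    then have "((\<lambda>p. (max 0 (?u p))\<^sup>2 * (1 / R ^ 4)) has_derivative (\<lambda>v. ?D v p)) (at p)"
      by (rule has_derivative_eq_rhs) (simp add: fun_eq_iff divide_inverse algebra_simps)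
    then show ?thesis by (simp add: cutoff_def[abs_def])
  qed
  have 2: "continuous_on UNIV (?D v)" for v
    \<comment> \<open>For \<open>R = 0\<close> division by zero yields 0, so the claimed derivative
      is constantly 0.\<close>
    by (cases "R = 0") (auto intro!: continuous_intros)
  show "C1_fun (cutoff R)" "dir_deriv v (cutoff R) p = ?D v p"
    using C1_funI[OF 1 2] by auto
qed

section \<open>Coordinates (x1, y) and the support of the cutoff\<close>

definition pt :: "real \<Rightarrow> real^2 \<Rightarrow> real^3" where
  "pt x y = vector [x, y $ 1, y $ 2]"

abbreviation e1 :: "real^3" where "e1 \<equiv> axis 1 1"
abbreviation e2 :: "real^3" where "e2 \<equiv> axis 2 1"
abbreviation e3 :: "real^3" where "e3 \<equiv> axis 3 1"

lemma pt_nth [simp]: "pt x y $ 1 = x" "pt x y $ 2 = y $ 1" "pt x y $ 3 = y $ 2"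
  by (simp_all add: pt_def)

lemma pt_eq: "pt x y = x *\<^sub>R e1 + (y $ 1) *\<^sub>R e2 + (y $ 2) *\<^sub>R e3"
  by (simp add: vec_eq_iff forall_3 axis_def)

lemma continuous_on_pt [continuous_intros]:
  assumes "continuous_on S f" "continuous_on S g"
  shows "continuous_on S (\<lambda>s. pt (f s) (g s))"
  unfolding pt_eq using assms by (intro continuous_intros)

lemma pt_add: "pt (x + a) y = pt x y + a *\<^sub>R e1"
  by (simp add: vec_eq_iff forall_3 axis_def)

lemma pt_shift:
  "pt x (y + s *\<^sub>R axis 1 1) = pt x y + s *\<^sub>R e2"
  "pt x (y + s *\<^sub>R axis 2 1) = pt x y + s *\<^sub>R e3"
  by (simp_all add: vec_eq_iff forall_3 axis_def)

lemma inner_e [simp]: "x \<bullet> e1 = x $ 1" "x \<bullet> e2 = x $ 2" "x \<bullet> e3 = x $ 3"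
  by (simp_all add: inner_axis)

text \<open>For 0 <= 3 t <= R the cutoff vanishes unless both components of y are below R in
  absolute value; the margin 1 leaves room for the translations by |s| < 1 in
  \<open>integral_dir_deriv_eq_0\<close>.\<close>

abbreviation ybox :: "real \<Rightarrow> (real^2) set" where
  "ybox R \<equiv> cbox (vec (- R - 1)) (vec (R + 1))"

lemma cutoff_nonneg: "0 \<le> cutoff R p"
  by (simp add: cutoff_def)

lemma cutoff_le_1:
  assumes "0 \<le> t" "3 * t \<le> R"
  shows "cutoff R (t, x) \<le> 1"
proof (cases "R = 0")
  case False
  have "(R - 3 * t)\<^sup>2 \<le> R\<^sup>2"
    using assms by (intro power_mono) auto
  then have "max 0 ((R - 3 * t)\<^sup>2 - x \<bullet> x) \<le> R\<^sup>2"
    by (auto intro: order_trans[of _ "(R - 3 * t)\<^sup>2"])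
  then have "(max 0 ((R - 3 * t)\<^sup>2 - x \<bullet> x))\<^sup>2 \<le> (R\<^sup>2)\<^sup>2"
    by (intro power_mono) auto
  then show ?thesis using False by (simp add: cutoff_def)
qed (simp add: cutoff_def)

lemma cutoff_eq_0:
  assumes "0 \<le> t" "3 * t \<le> R" "R \<le> \<bar>x $ i\<bar>"
  shows "cutoff R (t, x) = 0"
proof -
  have "(R - 3 * t)\<^sup>2 \<le> \<bar>x $ i\<bar>\<^sup>2"
    using assms by (intro power_mono) auto
  also have "\<dots> = (x $ i)\<^sup>2" by simp
  also have "\<dots> \<le> x \<bullet> x"
    using power_mono[OF component_le_norm_cart[of x i], of 2] by (simp add: power2_norm_eq_inner)
  finally show ?thesis by (simp add: cutoff_def)
qed

text \<open>On the support every |x_i| is at most \<rho> = R - 3 t, so the time derivative -3 \<mu>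
  \<rho> of the cutoff competes with three space derivatives of size at most \<mu> \<rho>. In the
  first bound the terms in \<open>q\<close> cancel, as 3 = 1 + 1 + 1, while \<open>p\<close> meets
  only the two transverse derivatives and leaves 2 \<mu> \<rho> p. In the second, moving the
  right-hand side over turns the longitudinal weight p + q into p - q, which is still at most p + q
  in size, so everything is absorbed.\<close>

lemma dir_deriv_cutoff_bounds:
  fixes x :: "real^3"
  assumes R: "0 \<le> t" "3 * t \<le> R" "0 < R" and \<tau>: "\<bar>\<tau>\<bar> \<le> 1"
    and nn: "0 \<le> p" "0 \<le> q" and Q: "\<bar>Q2\<bar> \<le> p + q" "\<bar>Q3\<bar> \<le> p + q"
  shows "dir_deriv (1, \<tau> *\<^sub>R e1) (cutoff R) (t, x) * q
       + dir_deriv (0, e2) (cutoff R) (t, x) * Q2 + dir_deriv (0, e3) (cutoff R) (t, x) * Q3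
       \<le> 8 / R * p" (is ?A)
    and "dir_deriv (1, \<tau> *\<^sub>R e1) (cutoff R) (t, x) * (p + q)
       + dir_deriv (0, e2) (cutoff R) (t, x) * Q2 + dir_deriv (0, e3) (cutoff R) (t, x) * Q3
       \<le> 2 * (dir_deriv (0, \<tau> *\<^sub>R e1) (cutoff R) (t, x) * q)" (is ?B)
proof -
  define \<rho> where "\<rho> = R - 3 * t"
  define u where "u = \<rho>\<^sup>2 - x \<bullet> x"
  define \<mu> where "\<mu> = 4 * max 0 u / R ^ 4"
  have \<rho>: "0 \<le> \<rho>" "\<rho> \<le> R" using R by (auto simp: \<rho>_def)
  have \<mu>: "0 \<le> \<mu>" by (simp add: \<mu>_def)
  have d: "dir_deriv (1, \<tau> *\<^sub>R e1) (cutoff R) (t, x) = - \<mu> * (3 * \<rho> + \<tau> * x $ 1)"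
    "dir_deriv (0, \<tau> *\<^sub>R e1) (cutoff R) (t, x) = - \<mu> * (\<tau> * x $ 1)"
    "dir_deriv (0, e2) (cutoff R) (t, x) = - \<mu> * x $ 2"
    "dir_deriv (0, e3) (cutoff R) (t, x) = - \<mu> * x $ 3"
    by (simp_all add: C1_fun_cutoff \<mu>_def u_def \<rho>_def)
  have "?A \<and> ?B"
  proof (cases "u \<le> 0")
    case True
    then have "\<mu> = 0" by (simp add: \<mu>_def)
    then show ?thesis using R nn by (simp add: d)
  next
    case False
    then have "(norm x)\<^sup>2 \<le> \<rho>\<^sup>2" by (simp add: u_def power2_norm_eq_inner)
    then have "norm x \<le> \<rho>" using \<rho>(1) by (rule power2_le_imp_le)
    then have x: "\<bar>x $ i\<bar> \<le> \<rho>" for i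
      using component_le_norm_cart[of x i] by linarith
    have x1: "\<bar>\<tau> * x $ 1\<bar> \<le> \<rho>"
      using mult_mono[OF \<tau> x[of 1]] \<rho> by (simp add: abs_mult)
    have x1q: "- (\<tau> * x $ 1 * q) \<le> \<rho> * q" "- (\<tau> * x $ 1 * (p - q)) \<le> \<rho> * (p + q)"
    proof -
      have "- (\<tau> * x $ 1) * q \<le> \<rho> * q"
        using x1 nn by (intro mult_right_mono) auto
      then show "- (\<tau> * x $ 1 * q) \<le> \<rho> * q" by simp
      have "\<bar>\<tau> * x $ 1\<bar> * \<bar>p - q\<bar> \<le> \<rho> * (p + q)"
        using x1 nn by (intro mult_mono) auto
      then show "- (\<tau> * x $ 1 * (p - q)) \<le> \<rho> * (p + q)"
        by (simp add: abs_mult[symmetric] abs_le_iff)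
    qed
    have xQ: "- (x $ i * Q) \<le> \<rho> * (p + q)" if "\<bar>Q\<bar> \<le> p + q" for i Q
    proof -
      have "\<bar>x $ i\<bar> * \<bar>Q\<bar> \<le> \<rho> * (p + q)"
        using x[of i] that nn \<rho> by (intro mult_mono) auto
      then show ?thesis by (simp add: abs_mult[symmetric] abs_le_iff)
    qed
    have "- ((3 * \<rho> + \<tau> * x $ 1) * q) - x $ 2 * Q2 - x $ 3 * Q3 \<le> 2 * \<rho> * p"
      using x1q(1) xQ[OF Q(1), of 2] xQ[OF Q(2), of 3] by (simp add: algebra_simps)
    from mult_left_mono[OF this \<mu>]
    have "- \<mu> * (3 * \<rho> + \<tau> * x $ 1) * q + - \<mu> * x $ 2 * Q2 + - \<mu> * x $ 3 * Q3 \<le> 2 * (\<mu> * \<rho>) * p"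
      by (simp add: algebra_simps)
    \<comment> \<open>From max 0 u <= R^2 and \<rho> <= R one gets \<mu> \<rho> <= 4 R^3 / R^4: the
      error decays as the cone grows.\<close>
    also have "\<dots> \<le> 2 * (4 / R) * p"
    proof -
      have "\<rho>\<^sup>2 \<le> R\<^sup>2" using \<rho> by (intro power_mono) auto
      then have "max 0 u \<le> R\<^sup>2"
        using inner_ge_zero[of x] False R unfolding u_def max_def by (simp del: inner_ge_zero)
      then have "4 * max 0 u * \<rho> / R ^ 4 \<le> 4 * R\<^sup>2 * R / R ^ 4"
        using \<rho> R by (intro divide_right_mono mult_mono) auto
      also have "\<dots> = 4 / R" using R by (simp add: field_simps power_eq_if)
      finally have "\<mu> * \<rho> \<le> 4 / R" by (simp add: \<mu>_def)
      then show ?thesis using nn by (intro mult_right_mono mult_left_mono) auto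
    qed
    finally have A: ?A by (simp add: d)
    have "0 \<le> 3 * \<rho> * (p + q) + \<tau> * x $ 1 * (p - q) + x $ 2 * Q2 + x $ 3 * Q3"
      using x1q(2) xQ[OF Q(1), of 2] xQ[OF Q(2), of 3] by (simp add: algebra_simps)
    from mult_left_mono[OF this \<mu>] have ?B by (simp add: d algebra_simps)
    with A show ?thesis by blast
  qed
  then show ?A ?B by auto
qed

text \<open>There are no boundary terms, since the cutoff kills the current near the edges of the
  box.\<close>

lemma integral_dir_deriv_cutoff:
  assumes Q: "C1_fun Q" and R: "0 \<le> t" "3 * t \<le> R"
  shows "integral (ybox R) (\<lambda>y. dir_deriv (0, e2) (\<lambda>w. cutoff R w * Q w) (t, pt x y)) = 0"
    and "integral (ybox R) (\<lambda>y. dir_deriv (0, e3) (\<lambda>w. cutoff R w * Q w) (t, pt x y)) = 0"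
proof -
  have KQ: "C1_fun (\<lambda>w. cutoff R w * Q w)" by (intro C1_fun_mult C1_fun_cutoff Q)
  have L: "continuous_on UNIV (\<lambda>y. (t, pt x y))" by (intro continuous_intros)
  have supp: "y \<in> ybox R" if "cutoff R (t, pt x (y + s *\<^sub>R axis k 1)) \<noteq> 0" "\<bar>s\<bar> < 1" for y s k
  proof -
    let ?y = "y + s *\<^sub>R axis k 1"
    have *: "\<bar>pt x ?y $ i\<bar> < R" for i
      using cutoff_eq_0[OF R, of "pt x ?y" i] that(1) by force
    have "\<bar>?y $ 1\<bar> < R" "\<bar>?y $ 2\<bar> < R" using *[of 2] *[of 3] by simp_all
    then show ?thesis using that(2)
      by (auto simp: mem_box_cart forall_2 axis_def abs_less_iff split: if_splits)
  qed
  show "integral (ybox R) (\<lambda>y. dir_deriv (0, e2) (\<lambda>w. cutoff R w * Q w) (t, pt x y)) = 0"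
    by (rule integral_dir_deriv_eq_0[OF KQ L, of "axis 1 1"])
      (use supp[where k = 1] in \<open>auto simp: pt_shift\<close>)
  show "integral (ybox R) (\<lambda>y. dir_deriv (0, e3) (\<lambda>w. cutoff R w * Q w) (t, pt x y)) = 0"
    by (rule integral_dir_deriv_eq_0[OF KQ L, of "axis 2 1"])
      (use supp[where k = 2] in \<open>auto simp: pt_shift\<close>)
qed

section \<open>From cutoff integrals to full integrals\<close>

lemma ennreal_integral_cbox:
  fixes f :: "'a::euclidean_space \<Rightarrow> real"
  assumes "continuous_on (cbox a b) f" "\<And>x. x \<in> cbox a b \<Longrightarrow> 0 \<le> f x"
  shows "ennreal (integral (cbox a b) f) = (\<integral>\<^sup>+ x\<in>cbox a b. ennreal (f x) \<partial>lborel)"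
  using nn_integral_has_integral_lebesgue'[OF assms(2) integrable_integral[OF integrable_continuous[OF assms(1)]]]
  by simp

text \<open>Dividing by \<open>R ^ 4\<close> leaves, under the positive part and the square, a
  polynomial in 1/R whose value at 1/R = 0 is 1.\<close>

lemma tendsto_cutoff: "(\<lambda>n. cutoff (real n) p) \<longlonglongrightarrow> 1"
proof -
  let ?t = "fst p" and ?c = "snd p \<bullet> snd p"
  have "(\<lambda>n. (max 0 ((1 - 3 * ?t * (1 / real n))\<^sup>2 - ?c * (1 / real n)\<^sup>2))\<^sup>2) \<longlonglongrightarrow>
      (max 0 ((1 - 3 * ?t * 0)\<^sup>2 - ?c * 0\<^sup>2))\<^sup>2"
    by (intro tendsto_intros lim_1_over_n)
  moreover have "\<forall>\<^sub>F n in sequentially.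
      (max 0 ((1 - 3 * ?t * (1 / real n))\<^sup>2 - ?c * (1 / real n)\<^sup>2))\<^sup>2 = cutoff (real n) p"
    using eventually_gt_at_top[of 0]
  proof eventually_elim
    case (elim n)
    have "(1 - 3 * ?t * (1 / real n))\<^sup>2 - ?c * (1 / real n)\<^sup>2 = ((real n - 3 * ?t)\<^sup>2 - ?c) / (real n)\<^sup>2"
      using elim by (simp add: field_simps power2_eq_square)
    then have "max 0 ((1 - 3 * ?t * (1 / real n))\<^sup>2 - ?c * (1 / real n)\<^sup>2)
        = max 0 ((real n - 3 * ?t)\<^sup>2 - ?c) / (real n)\<^sup>2"
      using elim by (simp add: max_def zero_le_divide_iff divide_le_0_iff)
    then show ?case by (simp add: cutoff_def power_divide)
  qed
  ultimately show ?thesis by (simp add: tendsto_cong)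
qed

text \<open>This is Fatou's lemma. An inequality is enough, because the cutoff integrals are only
  ever bounded from above.\<close>

lemma nn_integral_le_liminf_cutoff:
  assumes q: "continuous_on UNIV q" and nn: "\<And>w. 0 \<le> q w"
  shows "(\<integral>\<^sup>+ y. ennreal (q (t, pt x y)) \<partial>lborel)
    \<le> liminf (\<lambda>n. ennreal (integral (ybox (real n)) (\<lambda>y. cutoff (real n) (t, pt x y) * q (t, pt x y))))"
proof -
  have q': "continuous_on S (\<lambda>y. q (t, pt x y))" for S
    by (rule continuous_on_compose2[OF q]) (auto intro!: continuous_intros)
  have K': "continuous_on S (\<lambda>y. cutoff R (t, pt x y))" for S R
    by (intro continuous_on_C1_fun[OF C1_fun_cutoff(1)] continuous_intros)
  have meas: "(\<lambda>y. ennreal (cutoff R (t, pt x y) * q (t, pt x y))) \<in> borel_measurable borel" for R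
    by (intro borel_measurable_continuous_onI continuous_on_ennreal continuous_on_mult q' K')
  define f where "f n y = ennreal (cutoff (real n) (t, pt x y) * q (t, pt x y)) * indicator (ybox (real n)) y"
    for n y
  have [measurable]: "f n \<in> borel_measurable lborel" for n
    unfolding f_def using meas by simp
  have "(\<lambda>n. f n y) \<longlonglongrightarrow> ennreal (q (t, pt x y))" for y
  proof -
    have "(\<lambda>n. ennreal (cutoff (real n) (t, pt x y) * q (t, pt x y))) \<longlonglongrightarrow> ennreal (1 * q (t, pt x y))"
      by (intro tendsto_ennrealI tendsto_intros tendsto_cutoff)
    moreover have "\<forall>\<^sub>F n in sequentially.
        ennreal (cutoff (real n) (t, pt x y) * q (t, pt x y)) = f n y"
    proof -
      obtain N :: nat where "\<bar>y $ 1\<bar> + \<bar>y $ 2\<bar> \<le> real N" using real_arch_simple by blast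
      then have "\<forall>n\<ge>N. y \<in> ybox (real n)"
        by (auto simp: mem_box_cart forall_2)
      then show ?thesis unfolding eventually_sequentially f_def by (intro exI[of _ N]) auto
    qed
    ultimately show ?thesis by (simp add: tendsto_cong)
  qed
  then have "(\<integral>\<^sup>+ y. ennreal (q (t, pt x y)) \<partial>lborel) = (\<integral>\<^sup>+ y. liminf (\<lambda>n. f n y) \<partial>lborel)"
    by (intro nn_integral_cong lim_imp_Liminf[symmetric]) auto
  also have "\<dots> \<le> liminf (\<lambda>n. \<integral>\<^sup>+ y. f n y \<partial>lborel)"
    by (rule nn_integral_liminf) simp
  also have "(\<lambda>n. \<integral>\<^sup>+ y. f n y \<partial>lborel) =
      (\<lambda>n. ennreal (integral (ybox (real n)) (\<lambda>y. cutoff (real n) (t, pt x y) * q (t, pt x y))))"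
    unfolding f_def
    by (intro ext ennreal_integral_cbox[symmetric] continuous_on_mult q' K' mult_nonneg_nonneg cutoff_nonneg nn)
  finally show ?thesis .
qed

section \<open>Densities along null planes\<close>

lemma continuous_on_pt_comp:
  fixes f :: "real \<times> (real^3) \<Rightarrow> 'b::topological_space"
  assumes "continuous_on UNIV f" "continuous_on S a" "continuous_on S b" "continuous_on S c"
  shows "continuous_on S (\<lambda>s. f (a s, pt (b s) (c s)))"
  by (rule continuous_on_compose2[OF assms(1)]) (auto intro!: continuous_intros assms)

lemma borel_measurable_nn_integral_pt:
  fixes f :: "real \<times> (real^3) \<Rightarrow> real"
  assumes "continuous_on UNIV f"
  shows "(\<lambda>(t, x). \<integral>\<^sup>+ y. ennreal (f (t, pt x y)) \<partial>lborel) \<in> borel_measurable (borel \<Otimes>\<^sub>M borel)"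
proof -
  have "(\<lambda>w::(real \<times> real) \<times> (real^2). ennreal (f (fst (fst w), pt (snd (fst w)) (snd w)))) \<in> borel_measurable borel"
    by (intro borel_measurable_continuous_onI continuous_on_ennreal continuous_on_pt_comp[OF assms] continuous_intros)
  \<comment> \<open>The Borel sets of these products are the product sigma-algebra, so a continuous
    integrand is measurable in the sense that Tonelli's theorem asks for.\<close>
  moreover have "borel_measurable ((borel \<Otimes>\<^sub>M borel) \<Otimes>\<^sub>M lborel) =
      (borel_measurable borel :: ((real \<times> real) \<times> (real^2) \<Rightarrow> ennreal) set)"
  proof (rule measurable_cong_sets)
    have "sets ((borel \<Otimes>\<^sub>M borel) \<Otimes>\<^sub>M lborel)
        = sets ((borel :: (real \<times> real) measure) \<Otimes>\<^sub>M (borel :: (real^2) measure))"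
      by (intro sets_pair_measure_cong) (simp_all only: borel_prod sets_lborel)
    then show "sets ((borel \<Otimes>\<^sub>M borel) \<Otimes>\<^sub>M lborel) = sets (borel :: ((real \<times> real) \<times> (real^2)) measure)"
      by (simp only: borel_prod)
  qed simp
  ultimately have "(\<lambda>(w, y). ennreal (f (fst w, pt (snd w) y)))
      \<in> borel_measurable ((borel \<Otimes>\<^sub>M borel) \<Otimes>\<^sub>M lborel)"
    by (simp add: case_prod_beta)
  from lborel.borel_measurable_nn_integral[OF this] show ?thesis
    by (simp add: case_prod_beta)
qed

text \<open>Differentiate the cutoff integral of \<open>q\<close> over the plane moving with speed
  \<tau>: the transverse currents integrate to 0, the source gives \<open>F\<close>, and the
  derivatives of the cutoff cost at most 8/R times \<open>p\<close>. Thus \<open>p\<close> is the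
  part of the bound on the currents that \<open>q\<close> cannot absorb itself; it is 0 in the
  application to U and |U|^2 in the application to V.\<close>

lemma transport_bound:
  fixes p q Q2 Q3 F :: "real \<times> (real^3) \<Rightarrow> real"
  assumes C1: "C1_fun q" "C1_fun Q2" "C1_fun Q3"
    and cont: "continuous_on UNIV p" "continuous_on UNIV F"
    and nn: "\<And>w. 0 \<le> p w" "\<And>w. 0 \<le> q w" "\<And>w. 0 \<le> F w"
    and Q: "\<And>w. \<bar>Q2 w\<bar> \<le> p w + q w" "\<And>w. \<bar>Q3 w\<bar> \<le> p w + q w"
    and eq: "\<And>w. dir_deriv (1, \<tau> *\<^sub>R e1) q w + dir_deriv (0, e2) Q2 w + dir_deriv (0, e3) Q3 w \<le> F w"
    and \<tau>: "\<bar>\<tau>\<bar> \<le> 1"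
    and fin: "(\<integral>\<^sup>+ s\<in>{0..T}. (\<integral>\<^sup>+ y. ennreal (p (s, pt (x + \<tau> * s) y)) \<partial>lborel) \<partial>lborel) < \<infinity>"
    and t: "t \<in> {0..T}"
  shows "(\<integral>\<^sup>+ y. ennreal (q (t, pt (x + \<tau> * t) y)) \<partial>lborel)
    \<le> (\<integral>\<^sup>+ y. ennreal (q (0, pt x y)) \<partial>lborel)
      + (\<integral>\<^sup>+ s\<in>{0..T}. (\<integral>\<^sup>+ y. ennreal (F (s, pt (x + \<tau> * s) y)) \<partial>lborel) \<partial>lborel)"
    (is "_ \<le> ?A + ?I")
proof -
  let ?N = "\<integral>\<^sup>+ s\<in>{0..T}. (\<integral>\<^sup>+ y. ennreal (p (s, pt (x + \<tau> * s) y)) \<partial>lborel) \<partial>lborel"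
  have bound: "ennreal (integral (ybox R) (\<lambda>y. cutoff R (t, pt (x + \<tau> * t) y) * q (t, pt (x + \<tau> * t) y)))
      \<le> ?A + ?I + ennreal (8 / R) * ?N" if R: "0 < R" "3 * T \<le> R" for R
  proof -
    let ?K = "cutoff R"
    let ?\<gamma> = "\<lambda>s y. (s, pt (x + \<tau> * s) y)"
    define G where "G s = integral (ybox R) (\<lambda>y. ?K (?\<gamma> s y) * q (?\<gamma> s y))" for s
    define G' where "G' s = integral (ybox R) (\<lambda>y. dir_deriv (1, \<tau> *\<^sub>R e1) (\<lambda>w. ?K w * q w) (?\<gamma> s y))" for s
    define H where "H s = integral (ybox R) (\<lambda>y. F (?\<gamma> s y) + 8 / R * p (?\<gamma> s y))" for s
    note K = C1_fun_cutoff(1)[of R]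
    have Kq: "C1_fun (\<lambda>w. ?K w * q w)" "C1_fun (\<lambda>w. ?K w * Q2 w)" "C1_fun (\<lambda>w. ?K w * Q3 w)"
      by (intro C1_fun_mult K C1)+
    have FH: "continuous_on S (\<lambda>z. F (?\<gamma> (a z) (b z)) + 8 / R * p (?\<gamma> (a z) (b z)))"
      if "continuous_on S a" "continuous_on S b" for S :: "'c::topological_space set" and a b
      by (intro continuous_intros continuous_on_pt_comp[OF cont(1)] continuous_on_pt_comp[OF cont(2)] that)
    have \<gamma>: "continuous_on S (\<lambda>z. ?\<gamma> (a z) (b z))"
      if "continuous_on S a" "continuous_on S b" for S :: "'c::topological_space set" and a b
      by (intro continuous_intros that)
    have deriv: "(G has_real_derivative G' s) (at s)" for s
    proof -
      have *: "(0, pt x y) + s *\<^sub>R (1, \<tau> *\<^sub>R e1) = ?\<gamma> s y" for s y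
        by (simp add: pt_add mult.commute)
      have "continuous_on UNIV (\<lambda>y. (0, pt x y))" by (intro continuous_intros)
      from has_real_derivative_integral_line[OF Kq(1) this, of "vec (- R - 1)" "vec (R + 1)" "(1, \<tau> *\<^sub>R e1)" s]
      show ?thesis unfolding * G_def[abs_def] G'_def by simp
    qed
    have G'_le: "G' s \<le> H s" if s: "s \<in> {0..t}" for s
    proof -
      have s': "0 \<le> s" "3 * s \<le> R" using s t R by auto
      let ?D2 = "\<lambda>y. dir_deriv (0, e2) (\<lambda>w. ?K w * Q2 w) (?\<gamma> s y)"
      let ?D3 = "\<lambda>y. dir_deriv (0, e3) (\<lambda>w. ?K w * Q3 w) (?\<gamma> s y)"
      let ?D1 = "\<lambda>y. dir_deriv (1, \<tau> *\<^sub>R e1) (\<lambda>w. ?K w * q w) (?\<gamma> s y)"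
      have int: "?D1 integrable_on ybox R" "?D2 integrable_on ybox R" "?D3 integrable_on ybox R"
        by (intro integrable_continuous continuous_on_dir_deriv Kq \<gamma> continuous_intros)+
      have intH: "(\<lambda>y. F (?\<gamma> s y) + 8 / R * p (?\<gamma> s y)) integrable_on ybox R"
        by (intro integrable_continuous FH continuous_intros)
      \<comment> \<open>The two transverse derivatives are added for free, their integrals being 0;
        they complete the left-hand side of \<open>eq\<close>.\<close>
      have "?D1 y + ?D2 y + ?D3 y \<le> F (?\<gamma> s y) + 8 / R * p (?\<gamma> s y)" for y
      proof -
        let ?w = "?\<gamma> s y"
        have "?D1 y + ?D2 y + ?D3 y
            = ?K ?w * (dir_deriv (1, \<tau> *\<^sub>R e1) q ?w + dir_deriv (0, e2) Q2 ?w + dir_deriv (0, e3) Q3 ?w)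
            + (dir_deriv (1, \<tau> *\<^sub>R e1) ?K ?w * q ?w + dir_deriv (0, e2) ?K ?w * Q2 ?w + dir_deriv (0, e3) ?K ?w * Q3 ?w)"
          unfolding C1_fun_mult(2)[OF K C1(1)] C1_fun_mult(2)[OF K C1(2)] C1_fun_mult(2)[OF K C1(3)]
          by (simp add: algebra_simps)
        moreover have "?K ?w * (dir_deriv (1, \<tau> *\<^sub>R e1) q ?w + dir_deriv (0, e2) Q2 ?w + dir_deriv (0, e3) Q3 ?w)
            \<le> ?K ?w * F ?w"
          by (intro mult_left_mono eq cutoff_nonneg)
        moreover have "?K ?w * F ?w \<le> 1 * F ?w"
          by (intro mult_right_mono cutoff_le_1 s' nn)
        moreover note dir_deriv_cutoff_bounds(1)[OF s' R(1) \<tau> nn(1,2)[of ?w] Q[of ?w], of "pt (x + \<tau> * s) y"]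
        ultimately show ?thesis by linarith
      qed
      then have "integral (ybox R) (\<lambda>y. ?D1 y + ?D2 y + ?D3 y) \<le> H s"
        unfolding H_def by (intro integral_le integrable_add int intH)
      also have "integral (ybox R) (\<lambda>y. ?D1 y + ?D2 y + ?D3 y) = G' s"
        using int integral_dir_deriv_cutoff(1)[OF C1(2) s', of "x + \<tau> * s"]
          integral_dir_deriv_cutoff(2)[OF C1(3) s', of "x + \<tau> * s"]
        by (simp add: integral_add integrable_add G'_def)
      finally show ?thesis .
    qed
    have Hc: "continuous_on {0..t} H"
      unfolding H_def[abs_def] using FH[OF continuous_on_fst[OF continuous_on_id] continuous_on_snd[OF continuous_on_id]]
      by (intro integral_continuous_on_param) (simp add: case_prod_beta)
    have H0: "0 \<le> H s" for s
      unfolding H_def using nn R by (intro integral_nonneg integrable_continuous FH continuous_intros) auto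
    have "(G' has_integral (G t - G 0)) {0..t}"
      using t deriv
      by (intro fundamental_theorem_of_calculus)
        (auto simp: has_real_derivative_iff_has_vector_derivative[symmetric] intro: DERIV_subset)
    moreover have "(H has_integral integral {0..t} H) {0..t}"
      using Hc by (intro integrable_integral integrable_continuous_real)
    ultimately have "G t - G 0 \<le> integral {0..t} H"
      by (rule has_integral_le) (rule G'_le)
    then have "ennreal (G t) \<le> ennreal (G 0 + integral {0..t} H)"
      by (intro ennreal_leI) simp
    also have "\<dots> = ennreal (G 0) + ennreal (integral {0..t} H)"
      using Hc H0 cutoff_nonneg nn
      by (intro ennreal_plus integral_nonneg integrable_continuous_real)
        (auto simp: G_def intro!: integral_nonneg integrable_continuous continuous_on_C1_fun[OF Kq(1)] continuous_intros)
    also have "ennreal (G 0) \<le> ?A"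
    proof -
      have "ennreal (G 0) = (\<integral>\<^sup>+ y\<in>ybox R. ennreal (?K (?\<gamma> 0 y) * q (?\<gamma> 0 y)) \<partial>lborel)"
        unfolding G_def
        by (intro ennreal_integral_cbox continuous_on_C1_fun[OF Kq(1)] continuous_intros mult_nonneg_nonneg cutoff_nonneg nn)
      also have "\<dots> \<le> ?A"
      proof (intro nn_integral_mono)
        fix y
        have "?K (?\<gamma> 0 y) * q (?\<gamma> 0 y) \<le> 1 * q (?\<gamma> 0 y)"
          using R t by (intro mult_right_mono cutoff_le_1 nn) auto
        then show "ennreal (?K (?\<gamma> 0 y) * q (?\<gamma> 0 y)) * indicator (ybox R) y \<le> ennreal (q (0, pt x y))"
          by (auto simp: indicator_def intro: ennreal_leI)
      qed
      finally show ?thesis .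
    qed
    \<comment> \<open>All terms are nonnegative, so the box may grow to the whole plane and {0..t}
      to {0..T}, which removes t from the bound.\<close>
    also have "ennreal (integral {0..t} H) \<le> ?I + ennreal (8 / R) * ?N"
    proof -
      have meas: "(\<lambda>s. \<integral>\<^sup>+ y. ennreal (f (?\<gamma> s y)) \<partial>lborel) \<in> borel_measurable borel"
        if f: "continuous_on UNIV f" for f :: "real \<times> (real^3) \<Rightarrow> real"
      proof -
        have "(\<lambda>s. (s, x + \<tau> * s)) \<in> borel \<rightarrow>\<^sub>M borel \<Otimes>\<^sub>M borel"
          by (simp add: borel_prod borel_measurable_continuous_onI continuous_intros)
        from measurable_compose[OF this borel_measurable_nn_integral_pt[OF f]]
        show ?thesis by simp
      qed
      have "ennreal (integral {0..t} H) = (\<integral>\<^sup>+ s\<in>{0..t}. ennreal (H s) \<partial>lborel)"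
        using ennreal_integral_cbox[of 0 t H] Hc H0 by simp
      also have "\<dots> \<le> (\<integral>\<^sup>+ s. ((\<integral>\<^sup>+ y. ennreal (F (?\<gamma> s y)) \<partial>lborel) * indicator {0..T} s
          + ennreal (8 / R) * ((\<integral>\<^sup>+ y. ennreal (p (?\<gamma> s y)) \<partial>lborel) * indicator {0..T} s)) \<partial>lborel)"
      proof (intro nn_integral_mono)
        fix s
        have "ennreal (H s) = (\<integral>\<^sup>+ y\<in>ybox R. ennreal (F (?\<gamma> s y) + 8 / R * p (?\<gamma> s y)) \<partial>lborel)"
          unfolding H_def using nn R by (intro ennreal_integral_cbox FH continuous_intros) auto
        also have "\<dots> \<le> (\<integral>\<^sup>+ y. (ennreal (F (?\<gamma> s y)) + ennreal (8 / R) * ennreal (p (?\<gamma> s y))) \<partial>lborel)"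
          using nn R by (intro nn_integral_mono) (auto simp: indicator_def ennreal_mult[symmetric] ennreal_plus[symmetric] simp del: ennreal_plus)
        also have "\<dots> = (\<integral>\<^sup>+ y. ennreal (F (?\<gamma> s y)) \<partial>lborel) + ennreal (8 / R) * (\<integral>\<^sup>+ y. ennreal (p (?\<gamma> s y)) \<partial>lborel)"
        proof -
          have "(\<lambda>y. ennreal (f (?\<gamma> s y))) \<in> borel_measurable borel" if "continuous_on UNIV f" for f
            by (intro borel_measurable_continuous_onI continuous_on_ennreal continuous_on_pt_comp[OF that] continuous_intros)
          from this[OF cont(1)] this[OF cont(2)] show ?thesis
            by (simp add: nn_integral_add nn_integral_cmult)
        qed
        finally show "ennreal (H s) * indicator {0..t} s
          \<le> (\<integral>\<^sup>+ y. ennreal (F (?\<gamma> s y)) \<partial>lborel) * indicator {0..T} s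
          + ennreal (8 / R) * ((\<integral>\<^sup>+ y. ennreal (p (?\<gamma> s y)) \<partial>lborel) * indicator {0..T} s)"
          using t by (auto simp: indicator_def)
      qed
      also have "\<dots> = ?I + ennreal (8 / R) * ?N"
        using meas[OF cont(1)] meas[OF cont(2)] by (simp add: nn_integral_add nn_integral_cmult)
      finally show ?thesis .
    qed
    finally show ?thesis by (simp add: G_def add.assoc add_mono)
  qed
  \<comment> \<open>In \<open>ennreal\<close> the product of 8/R and infinity is infinite for every
    R > 0, so the error tends to 0 only because \<open>?N\<close> is finite.\<close>
  obtain N where N: "?N = ennreal N" "0 \<le> N" using fin by (cases ?N) auto
  have "(\<integral>\<^sup>+ y. ennreal (q (t, pt (x + \<tau> * t) y)) \<partial>lborel)
      \<le> liminf (\<lambda>n. ennreal (integral (ybox (real n)) (\<lambda>y. cutoff (real n) (t, pt (x + \<tau> * t) y) * q (t, pt (x + \<tau> * t) y))))"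
    by (intro nn_integral_le_liminf_cutoff nn continuous_on_C1_fun[OF C1(1) continuous_on_id])
  also have "\<dots> \<le> liminf (\<lambda>n. ?A + ?I + ennreal (8 / real n) * ?N)"
  proof (rule Liminf_mono)
    obtain n0 :: nat where "3 * T \<le> real n0" using real_arch_simple by blast
    then have "\<forall>n\<ge>max 1 n0. 0 < real n \<and> 3 * T \<le> real n" by auto
    then have "\<forall>\<^sub>F n in sequentially. 0 < real n \<and> 3 * T \<le> real n"
      unfolding eventually_sequentially by blast
    then show "\<forall>\<^sub>F n in sequentially.
        ennreal (integral (ybox (real n)) (\<lambda>y. cutoff (real n) (t, pt (x + \<tau> * t) y) * q (t, pt (x + \<tau> * t) y)))
        \<le> ?A + ?I + ennreal (8 / real n) * ?N"
      by eventually_elim (use bound in auto)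
  qed
  also have "\<dots> = ?A + ?I + 0"
  proof (rule lim_imp_Liminf)
    have "(\<lambda>n. 8 * N * (1 / real n)) \<longlonglongrightarrow> 8 * N * 0" by (intro tendsto_intros lim_1_over_n)
    then have "(\<lambda>n. ennreal (8 * N * (1 / real n))) \<longlonglongrightarrow> ennreal 0"
      by (intro tendsto_ennrealI) simp
    moreover have "ennreal (8 * N * (1 / real n)) = ennreal (8 / real n) * ?N" for n
      using N by (simp add: ennreal_mult[symmetric])
    ultimately have "(\<lambda>n. ennreal (8 / real n) * ?N) \<longlonglongrightarrow> 0" by simp
    then show "(\<lambda>n. ?A + ?I + ennreal (8 / real n) * ?N) \<longlonglongrightarrow> ?A + ?I + 0"
      by (intro tendsto_add tendsto_const)
  qed simp
  finally show ?thesis by simp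
qed

text \<open>The region beyond the plane x1 = x + \<tau> t gets a coordinate r >= 0 that moves with
  the plane, so the domain is fixed. In this frame the conservation law says that the t-derivative
  of p + q plus the transverse divergence is twice the r-derivative of q. Integrating over r leaves
  -2 q at r = 0, the flux through the plane, and the cutoff only helps the inequality.\<close>

lemma flux_bound_cutoff:
  fixes p q Q2 Q3 :: "real \<times> (real^3) \<Rightarrow> real" and x :: real
  assumes C1: "C1_fun p" "C1_fun q" "C1_fun Q2" "C1_fun Q3"
    and nn: "\<And>w. 0 \<le> p w" "\<And>w. 0 \<le> q w"
    and Q: "\<And>w. \<bar>Q2 w\<bar> \<le> p w + q w" "\<And>w. \<bar>Q3 w\<bar> \<le> p w + q w"
    and eq: "\<And>w. dir_deriv (1, \<tau> *\<^sub>R e1) p w + dir_deriv (1, - \<tau> *\<^sub>R e1) q w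
        + dir_deriv (0, e2) Q2 w + dir_deriv (0, e3) Q3 w = 0"
    and \<tau>: "\<bar>\<tau>\<bar> = 1"
    and R: "0 < R" "3 * T \<le> R" and T: "0 \<le> T"
  defines "M \<equiv> 2 * R + \<bar>x\<bar>"
  shows "2 * integral {0..T} (\<lambda>t. integral (ybox R) (\<lambda>y. cutoff R (t, pt (x + \<tau> * t) y) * q (t, pt (x + \<tau> * t) y)))
    \<le> integral {0..M} (\<lambda>r. integral (ybox R) (\<lambda>y. cutoff R (0, pt (x + \<tau> * r) y) * (p (0, pt (x + \<tau> * r) y) + q (0, pt (x + \<tau> * r) y))))"
proof -
  let ?K = "cutoff R"
  let ?\<gamma> = "\<lambda>t r y. (t, pt (x + \<tau> * (t + r)) y)"
  let ?Kq = "\<lambda>w. ?K w * q w" and ?Kpq = "\<lambda>w. ?K w * (p w + q w)"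
  define \<beta> where "\<beta> t r = integral (ybox R) (\<lambda>y. ?Kq (?\<gamma> t r y))" for t r
  define \<beta>' where "\<beta>' t r = integral (ybox R) (\<lambda>y. dir_deriv (0, \<tau> *\<^sub>R e1) ?Kq (?\<gamma> t r y))" for t r
  define e where "e t r = integral (ybox R) (\<lambda>y. ?Kpq (?\<gamma> t r y))" for t r
  define e' where "e' t r = integral (ybox R) (\<lambda>y. dir_deriv (1, \<tau> *\<^sub>R e1) ?Kpq (?\<gamma> t r y))" for t r
  define E where "E t = integral {0..M} (e t)" for t
  have M: "0 \<le> M" using R by (simp add: M_def)
  note K = C1_fun_cutoff(1)[of R]
  have pq: "C1_fun (\<lambda>w. p w + q w)" by (intro C1_fun_add C1)
  have Kq: "C1_fun ?Kq" "C1_fun (\<lambda>w. ?K w * Q2 w)" "C1_fun (\<lambda>w. ?K w * Q3 w)" "C1_fun ?Kpq"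
    by (intro C1_fun_mult K C1 pq)+
  have \<gamma>: "continuous_on S (\<lambda>z. ?\<gamma> (a z) (b z) (c z))"
    if "continuous_on S a" "continuous_on S b" "continuous_on S c" for S :: "'c::topological_space set" and a b c
    by (intro continuous_intros that)
  have joint: "continuous_on S (\<lambda>(t, r). integral (ybox R) (\<lambda>y. f (?\<gamma> t r y)))"
    if f: "continuous_on UNIV f" for f :: "real \<times> (real^3) \<Rightarrow> real" and S
  proof -
    have "continuous_on S (\<lambda>z. integral (ybox R) (\<lambda>y. f (?\<gamma> (fst z) (snd z) y)))"
    proof (rule integral_continuous_on_param)
      have "continuous_on (S \<times> ybox R) (\<lambda>z. f (?\<gamma> (fst (fst z)) (snd (fst z)) (snd z)))"
        by (intro continuous_on_pt_comp[OF f] continuous_intros)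
      then show "continuous_on (S \<times> ybox R) (\<lambda>(z, y). f (?\<gamma> (fst z) (snd z) y))"
        by (simp add: case_prod_beta)
    qed
    then show ?thesis by (simp add: case_prod_beta)
  qed
  have slice: "continuous_on S (g t)" if "\<And>S. continuous_on S (\<lambda>(t, r). g t r)" for g :: "real \<Rightarrow> real \<Rightarrow> real" and S t
  proof -
    have "continuous_on S (\<lambda>r. (\<lambda>(t, r). g t r) (t, r))"
      by (rule continuous_on_compose2[OF that[of UNIV]]) (auto intro!: continuous_intros)
    then show ?thesis by simp
  qed
  have e_cont: "continuous_on S (\<lambda>(t, r). e t r)" for S
    unfolding e_def by (intro joint continuous_on_C1_fun[OF Kq(4) continuous_on_id])
  have e'_cont: "continuous_on S (\<lambda>(t, r). e' t r)" for S
    unfolding e'_def by (intro joint continuous_on_dir_deriv[OF Kq(4) continuous_on_id])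
  have \<beta>'_cont: "continuous_on S (\<lambda>(t, r). \<beta>' t r)" for S
    unfolding \<beta>'_def by (intro joint continuous_on_dir_deriv[OF Kq(1) continuous_on_id])
  have \<beta>_cont: "continuous_on S (\<lambda>(t, r). \<beta> t r)" for S
    unfolding \<beta>_def by (intro joint continuous_on_C1_fun[OF Kq(1) continuous_on_id])
  have e_deriv: "((\<lambda>t. e t r) has_real_derivative e' t r) (at t)" for t r
  proof -
    have *: "(0, pt (x + \<tau> * r) y) + t *\<^sub>R (1, \<tau> *\<^sub>R e1) = ?\<gamma> t r y" for t y
      using pt_add[of "x + \<tau> * r" "\<tau> * t" y] by (simp add: algebra_simps)
    have "continuous_on UNIV (\<lambda>y. (0, pt (x + \<tau> * r) y))" by (intro continuous_intros)
    from has_real_derivative_integral_line[OF Kq(4) this, of "vec (- R - 1)" "vec (R + 1)" "(1, \<tau> *\<^sub>R e1)" t]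
    show ?thesis unfolding * e_def e'_def by simp
  qed
  have \<beta>_deriv: "(\<beta> t has_real_derivative \<beta>' t r) (at r)" for t r
  proof -
    have *: "(t, pt (x + \<tau> * t) y) + r *\<^sub>R (0, \<tau> *\<^sub>R e1) = ?\<gamma> t r y" for r y
      using pt_add[of "x + \<tau> * t" "\<tau> * r" y] by (simp add: algebra_simps)
    have "continuous_on UNIV (\<lambda>y. (t, pt (x + \<tau> * t) y))" by (intro continuous_intros)
    from has_real_derivative_integral_line[OF Kq(1) this, of "vec (- R - 1)" "vec (R + 1)" "(0, \<tau> *\<^sub>R e1)" r]
    show ?thesis unfolding * \<beta>_def[abs_def] \<beta>'_def by simp
  qed
  have E_deriv: "(E has_real_derivative integral {0..M} (e' t)) (at t)" for t
    using leibniz_rule_field_derivative[of UNIV 0 M e e' t] e_deriv slice[OF e_cont] e'_cont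
    by (simp add: E_def[abs_def] integrable_continuous_real)
  have e'_le: "e' t r \<le> 2 * \<beta>' t r" if t: "t \<in> {0..T}" for t r
  proof -
    have t': "0 \<le> t" "3 * t \<le> R" using t R by auto
    let ?D0 = "\<lambda>y. dir_deriv (0, \<tau> *\<^sub>R e1) ?Kq (?\<gamma> t r y)"
    let ?D1 = "\<lambda>y. dir_deriv (1, \<tau> *\<^sub>R e1) ?Kpq (?\<gamma> t r y)"
    let ?D2 = "\<lambda>y. dir_deriv (0, e2) (\<lambda>w. ?K w * Q2 w) (?\<gamma> t r y)"
    let ?D3 = "\<lambda>y. dir_deriv (0, e3) (\<lambda>w. ?K w * Q3 w) (?\<gamma> t r y)"
    have int: "?D0 integrable_on ybox R" "?D1 integrable_on ybox R" "?D2 integrable_on ybox R" "?D3 integrable_on ybox R"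
      by (intro integrable_continuous continuous_on_dir_deriv Kq \<gamma> continuous_intros)+
    have "?D1 y + ?D2 y + ?D3 y \<le> 2 * ?D0 y" for y
    proof -
      let ?w = "?\<gamma> t r y"
      \<comment> \<open>\<open>q\<close> obeys its law along the opposite null direction; passing to
        the moving frame costs the factor 2, the relative speed of the two directions.\<close>
      have "(1, \<tau> *\<^sub>R e1) = 1 *\<^sub>R (1, - \<tau> *\<^sub>R e1) + 2 *\<^sub>R (0::real, \<tau> *\<^sub>R e1)"
        by (simp add: vec_eq_iff)
      then have "dir_deriv (1, \<tau> *\<^sub>R e1) q ?w = dir_deriv (1, - \<tau> *\<^sub>R e1) q ?w + 2 * dir_deriv (0, \<tau> *\<^sub>R e1) q ?w"
        using dir_deriv_sum_scale[OF C1(2), of 1 "(1, - \<tau> *\<^sub>R e1)" 2 "(0, \<tau> *\<^sub>R e1)" ?w]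
        by (simp only: scaleR_one real_scaleR_def mult_1)
      then have "dir_deriv (1, \<tau> *\<^sub>R e1) p ?w + dir_deriv (1, \<tau> *\<^sub>R e1) q ?w + dir_deriv (0, e2) Q2 ?w + dir_deriv (0, e3) Q3 ?w
          = 2 * dir_deriv (0, \<tau> *\<^sub>R e1) q ?w"
        using eq[of ?w] by linarith
      moreover have "?D1 y + ?D2 y + ?D3 y
          = ?K ?w * (dir_deriv (1, \<tau> *\<^sub>R e1) p ?w + dir_deriv (1, \<tau> *\<^sub>R e1) q ?w + dir_deriv (0, e2) Q2 ?w + dir_deriv (0, e3) Q3 ?w)
          + (dir_deriv (1, \<tau> *\<^sub>R e1) ?K ?w * (p ?w + q ?w) + dir_deriv (0, e2) ?K ?w * Q2 ?w + dir_deriv (0, e3) ?K ?w * Q3 ?w)"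
        unfolding C1_fun_mult(2)[OF K pq] C1_fun_add(2)[OF C1(1,2)] C1_fun_mult(2)[OF K C1(3)] C1_fun_mult(2)[OF K C1(4)]
        by (simp add: algebra_simps)
      moreover have "2 * ?D0 y = ?K ?w * (2 * dir_deriv (0, \<tau> *\<^sub>R e1) q ?w) + 2 * (dir_deriv (0, \<tau> *\<^sub>R e1) ?K ?w * q ?w)"
        unfolding C1_fun_mult(2)[OF K C1(2)] by (simp add: algebra_simps)
      moreover note dir_deriv_cutoff_bounds(2)[OF t' R(1) eq_refl[OF \<tau>] nn(1,2)[of ?w] Q[of ?w], of "pt (x + \<tau> * (t + r)) y"]
      ultimately show ?thesis by simp
    qed
    then have "integral (ybox R) (\<lambda>y. ?D1 y + ?D2 y + ?D3 y) \<le> integral (ybox R) (\<lambda>y. 2 * ?D0 y)"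
      by (intro integral_le integrable_add integrable_on_mult_right int)
    then show ?thesis
      using int integral_dir_deriv_cutoff(1)[OF C1(3) t', of "x + \<tau> * (t + r)"]
        integral_dir_deriv_cutoff(2)[OF C1(4) t', of "x + \<tau> * (t + r)"]
      by (simp add: integral_add integrable_add e'_def \<beta>'_def)
  qed
  have E'_le: "integral {0..M} (e' t) \<le> - 2 * \<beta> t 0" if t: "t \<in> {0..T}" for t
  proof -
    have t': "0 \<le> t" "3 * t \<le> R" using t R by auto
    have "(\<beta>' t has_integral (\<beta> t M - \<beta> t 0)) {0..M}"
      using M \<beta>_deriv
      by (intro fundamental_theorem_of_calculus)
        (auto simp: has_real_derivative_iff_has_vector_derivative[symmetric] intro: DERIV_subset)
    then have \<beta>int: "((\<lambda>r. 2 * \<beta>' t r) has_integral (2 * (\<beta> t M - \<beta> t 0))) {0..M}"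
      by (rule has_integral_mult_right)
    have "(e' t has_integral integral {0..M} (e' t)) {0..M}"
      by (intro integrable_integral integrable_continuous_real slice[OF e'_cont])
    then have "integral {0..M} (e' t) \<le> 2 * (\<beta> t M - \<beta> t 0)"
      by (rule has_integral_le[OF _ \<beta>int]) (rule e'_le[OF t])
    \<comment> \<open>Since t + M is at least 2 R + |x|, the far edge r = M has first coordinate at
      least 2 R in absolute value and misses the cone.\<close>
    moreover have "\<beta> t M = 0"
    proof -
      have "R \<le> \<bar>x + \<tau> * (t + M)\<bar>"
      proof -
        have "\<bar>\<tau> * (t + M)\<bar> = t + M" using \<tau> t' M by (simp add: abs_mult)
        then show ?thesis using t' R unfolding M_def by linarith
      qed
      then have "?Kq (?\<gamma> t M y) = 0" for y
        using cutoff_eq_0[OF t', of "pt (x + \<tau> * (t + M)) y" 1] by simp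
      then show ?thesis unfolding \<beta>_def by (simp only: integral_0)
    qed
    ultimately show ?thesis by simp
  qed
  have "((\<lambda>t. integral {0..M} (e' t)) has_integral (E T - E 0)) {0..T}"
    using T E_deriv
    by (intro fundamental_theorem_of_calculus)
      (auto simp: has_real_derivative_iff_has_vector_derivative[symmetric] intro: DERIV_subset)
  moreover have "((\<lambda>t. - 2 * \<beta> t 0) has_integral (- 2 * integral {0..T} (\<lambda>t. \<beta> t 0))) {0..T}"
  proof -
    have "continuous_on {0..T} (\<lambda>t. (\<lambda>(t, r). \<beta> t r) (t, 0))"
      by (rule continuous_on_compose2[OF \<beta>_cont[of UNIV]]) (auto intro!: continuous_intros)
    then show ?thesis
      by (intro has_integral_mult_right integrable_integral integrable_continuous_real) simp
  qed
  ultimately have "E T - E 0 \<le> - 2 * integral {0..T} (\<lambda>t. \<beta> t 0)"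
    by (rule has_integral_le) (rule E'_le)
  \<comment> \<open>What is still beyond the plane at time T is nonnegative and is dropped.\<close>
  moreover have "0 \<le> e T r" for r
    unfolding e_def using nn
    by (intro integral_nonneg integrable_continuous continuous_on_C1_fun[OF Kq(4)] \<gamma> continuous_intros)
      (auto intro!: mult_nonneg_nonneg cutoff_nonneg add_nonneg_nonneg)
  then have "0 \<le> E T"
    unfolding E_def by (intro integral_nonneg integrable_continuous_real slice[OF e_cont]) auto
  ultimately have "2 * integral {0..T} (\<lambda>t. \<beta> t 0) \<le> E 0" by linarith
  then show ?thesis by (simp add: \<beta>_def E_def e_def[abs_def])
qed

lemma two_mult_divide_ennreal: "2 * a / 2 = (a :: ennreal)"
  using ennreal_mult_divide_eq[of 2 a] by (simp add: mult.commute[of a 2])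

text \<open>Let R grow in \<open>flux_bound_cutoff\<close>, using Fatou in y for each t and then in
  t. The interval of initial positions is enlarged to the whole line, so the bound is the same for
  every plane of the family.\<close>

lemma flux_bound:
  fixes p q Q2 Q3 :: "real \<times> (real^3) \<Rightarrow> real"
  assumes C1: "C1_fun p" "C1_fun q" "C1_fun Q2" "C1_fun Q3"
    and nn: "\<And>w. 0 \<le> p w" "\<And>w. 0 \<le> q w"
    and Q: "\<And>w. \<bar>Q2 w\<bar> \<le> p w + q w" "\<And>w. \<bar>Q3 w\<bar> \<le> p w + q w"
    and eq: "\<And>w. dir_deriv (1, \<tau> *\<^sub>R e1) p w + dir_deriv (1, - \<tau> *\<^sub>R e1) q w
        + dir_deriv (0, e2) Q2 w + dir_deriv (0, e3) Q3 w = 0"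
    and \<tau>: "\<bar>\<tau>\<bar> = 1" and T: "0 \<le> T"
  shows "2 * (\<integral>\<^sup>+ t\<in>{0..T}. (\<integral>\<^sup>+ y. ennreal (q (t, pt (x + \<tau> * t) y)) \<partial>lborel) \<partial>lborel)
    \<le> (\<integral>\<^sup>+ r. (\<integral>\<^sup>+ y. ennreal (p (0, pt r y) + q (0, pt r y)) \<partial>lborel) \<partial>lborel)" (is "2 * ?L \<le> ?N")
proof -
  let ?b = "\<lambda>R t. integral (ybox R) (\<lambda>y. cutoff R (t, pt (x + \<tau> * t) y) * q (t, pt (x + \<tau> * t) y))"
  have pq: "C1_fun (\<lambda>w. p w + q w)" by (intro C1_fun_add C1)
  have Kc: "continuous_on UNIV (\<lambda>w. cutoff R w * f w)" if "C1_fun f" for f R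
    by (intro continuous_on_C1_fun[OF C1_fun_mult(1)[OF C1_fun_cutoff(1) that]] continuous_on_id)
  have pqc: "continuous_on UNIV (\<lambda>w. p w + q w)" by (rule continuous_on_C1_fun[OF pq continuous_on_id])
  have slice: "continuous_on S (\<lambda>t. integral (ybox R) (\<lambda>y. f (a t, pt (x + \<tau> * t) y)))"
    if "continuous_on UNIV f" "continuous_on UNIV a" for f :: "real \<times> (real^3) \<Rightarrow> real" and a R S
  proof (rule integral_continuous_on_param)
    have "continuous_on (S \<times> ybox R) (\<lambda>z. f (a (fst z), pt (x + \<tau> * fst z) (snd z)))"
      by (intro continuous_on_pt_comp[OF that(1)] continuous_on_compose2[OF that(2)] continuous_intros) auto
    then show "continuous_on (S \<times> ybox R) (\<lambda>(t, y). f (a t, pt (x + \<tau> * t) y))"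
      by (simp add: case_prod_beta)
  qed
  have b_cont: "continuous_on S (?b R)" for R S
    using slice[OF Kc[OF C1(2)] continuous_on_id] by simp
  have b_nn: "0 \<le> ?b R t" for R t
    using nn by (intro integral_nonneg integrable_continuous continuous_on_pt_comp[OF Kc[OF C1(2)]] continuous_intros)
      (auto intro!: mult_nonneg_nonneg cutoff_nonneg)
  have bound: "2 * (\<integral>\<^sup>+ t\<in>{0..T}. ennreal (?b R t) \<partial>lborel) \<le> ?N" if R: "0 < R" "3 * T \<le> R" for R
  proof -
    define M where "M = 2 * R + \<bar>x\<bar>"
    let ?e = "\<lambda>r. integral (ybox R) (\<lambda>y. cutoff R (0, pt (x + \<tau> * r) y) * (p (0, pt (x + \<tau> * r) y) + q (0, pt (x + \<tau> * r) y)))"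
    have e_cont: "continuous_on S ?e" for S
      using slice[OF Kc[OF pq] continuous_on_const] by simp
    have e_nn: "0 \<le> ?e r" for r
      using nn by (intro integral_nonneg integrable_continuous continuous_on_pt_comp[OF Kc[OF pq]] continuous_intros)
        (auto intro!: mult_nonneg_nonneg cutoff_nonneg add_nonneg_nonneg)
    have "2 * (\<integral>\<^sup>+ t\<in>{0..T}. ennreal (?b R t) \<partial>lborel) = 2 * ennreal (integral {0..T} (?b R))"
      using ennreal_integral_cbox[of 0 T "?b R"] b_cont b_nn by simp
    also have "\<dots> = ennreal (2 * integral {0..T} (?b R))"
      using b_nn b_cont by (simp add: ennreal_mult integral_nonneg integrable_continuous_real)
    also have "\<dots> \<le> ennreal (integral {0..M} ?e)"
      using flux_bound_cutoff[OF C1 nn Q eq \<tau> R T, of x] by (intro ennreal_leI) (simp add: M_def)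
    also have "\<dots> = (\<integral>\<^sup>+ r\<in>{0..M}. ennreal (?e r) \<partial>lborel)"
      using ennreal_integral_cbox[of 0 M ?e] e_cont e_nn by simp
    also have "\<dots> \<le> (\<integral>\<^sup>+ r. (\<integral>\<^sup>+ y. ennreal (p (0, pt (x + \<tau> * r) y) + q (0, pt (x + \<tau> * r) y)) \<partial>lborel) \<partial>lborel)"
    proof (intro nn_integral_mono)
      fix r
      have "ennreal (?e r) = (\<integral>\<^sup>+ y\<in>ybox R. ennreal (cutoff R (0, pt (x + \<tau> * r) y) * (p (0, pt (x + \<tau> * r) y) + q (0, pt (x + \<tau> * r) y))) \<partial>lborel)"
        using nn
        by (intro ennreal_integral_cbox continuous_on_pt_comp[OF Kc[OF pq]] continuous_intros
            mult_nonneg_nonneg cutoff_nonneg add_nonneg_nonneg)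
      also have "\<dots> \<le> (\<integral>\<^sup>+ y. ennreal (p (0, pt (x + \<tau> * r) y) + q (0, pt (x + \<tau> * r) y)) \<partial>lborel)"
      proof (intro nn_integral_mono)
        fix y
        let ?w = "(0, pt (x + \<tau> * r) y)"
        have "cutoff R ?w * (p ?w + q ?w) \<le> 1 * (p ?w + q ?w)"
          using R nn by (intro mult_right_mono cutoff_le_1 add_nonneg_nonneg) auto
        then show "ennreal (cutoff R ?w * (p ?w + q ?w)) * indicator (ybox R) y \<le> ennreal (p ?w + q ?w)"
          by (auto simp: indicator_def intro: ennreal_leI)
      qed
      finally show "ennreal (?e r) * indicator {0..M} r \<le> (\<integral>\<^sup>+ y. ennreal (p (0, pt (x + \<tau> * r) y) + q (0, pt (x + \<tau> * r) y)) \<partial>lborel)"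
        by (auto simp: indicator_def)
    qed
    \<comment> \<open>As |\<tau>| = 1, the map taking r to x + \<tau> r preserves Lebesgue
      measure.\<close>
    also have "\<dots> = ?N"
    proof -
      have "(\<lambda>r. (0::real, r::real)) \<in> borel \<rightarrow>\<^sub>M borel \<Otimes>\<^sub>M borel" by simp
      from measurable_compose[OF this borel_measurable_nn_integral_pt[OF pqc]]
      have "(\<lambda>r. \<integral>\<^sup>+ y. ennreal (p (0, pt r y) + q (0, pt r y)) \<partial>lborel) \<in> borel_measurable borel"
        by simp
      from nn_integral_real_affine[OF this, of \<tau> x] \<tau> show ?thesis by auto
    qed
    finally show ?thesis .
  qed
  have "?L \<le> (\<integral>\<^sup>+ t. liminf (\<lambda>n. ennreal (?b (real n) t) * indicator {0..T} t) \<partial>lborel)"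
  proof (intro nn_integral_mono)
    fix t
    have "(\<integral>\<^sup>+ y. ennreal (q (t, pt (x + \<tau> * t) y)) \<partial>lborel) \<le> liminf (\<lambda>n. ennreal (?b (real n) t))"
      by (intro nn_integral_le_liminf_cutoff nn continuous_on_C1_fun[OF C1(2) continuous_on_id])
    then show "(\<integral>\<^sup>+ y. ennreal (q (t, pt (x + \<tau> * t) y)) \<partial>lborel) * indicator {0..T} t
        \<le> liminf (\<lambda>n. ennreal (?b (real n) t) * indicator {0..T} t)"
      by (auto simp: indicator_def)
  qed
  also have "\<dots> \<le> liminf (\<lambda>n. \<integral>\<^sup>+ t\<in>{0..T}. ennreal (?b (real n) t) \<partial>lborel)"
  proof (rule nn_integral_liminf)
    show "(\<lambda>t. ennreal (?b (real n) t) * indicator {0..T} t) \<in> borel_measurable lborel" for n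
      using borel_measurable_continuous_onI[OF continuous_on_ennreal[OF b_cont[of UNIV "real n"]]] by simp
  qed
  \<comment> \<open>Dividing by 2 gives a bound that is constant in n; in \<open>ennreal\<close>
    this is sound also when \<open>?N\<close> is infinite.\<close>
  also have "\<dots> \<le> liminf (\<lambda>n::nat. ?N / 2)"
  proof (rule Liminf_mono)
    obtain n0 :: nat where "3 * T \<le> real n0" using real_arch_simple by blast
    then have "\<forall>n\<ge>max 1 n0. 0 < real n \<and> 3 * T \<le> real n" by auto
    then have "\<forall>\<^sub>F n in sequentially. 0 < real n \<and> 3 * T \<le> real n"
      unfolding eventually_sequentially by blast
    then show "\<forall>\<^sub>F n in sequentially. (\<integral>\<^sup>+ t\<in>{0..T}. ennreal (?b (real n) t) \<partial>lborel) \<le> ?N / 2"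
    proof eventually_elim
      case (elim n)
      have "(\<integral>\<^sup>+ t\<in>{0..T}. ennreal (?b (real n) t) \<partial>lborel)
          = 2 * (\<integral>\<^sup>+ t\<in>{0..T}. ennreal (?b (real n) t) \<partial>lborel) / 2"
        by (simp only: two_mult_divide_ennreal)
      also have "\<dots> \<le> ?N / 2" using elim by (intro divide_right_mono_ennreal bound) auto
      finally show ?case .
    qed
  qed
  also have "\<dots> = ?N / 2" by (rule Liminf_const) simp
  finally have "2 * ?L \<le> 2 * (?N / 2)" by (intro mult_left_mono) auto
  also have "\<dots> = ?N" by (simp only: ennreal_times_divide two_mult_divide_ennreal)
  finally show ?thesis .
qed

section \<open>Tonelli's theorem for line times plane and along characteristics\<close>

lemma prod_Basis_vec: "(\<Prod>b\<in>Basis. x \<bullet> b) = (\<Prod>i\<in>UNIV. x $ i)" for x :: "real^'n"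
proof -
  have 1: "(Basis :: (real^'n) set) = (\<lambda>i. axis i 1) ` UNIV" by (auto simp: Basis_vec_def)
  have "inj (\<lambda>i::'n. axis i (1::real))" by (auto simp: inj_on_def axis_eq_axis)
  then show ?thesis
    unfolding 1 by (subst prod.reindex) (auto simp: inner_axis)
qed

lemma measurable_pt: "(\<lambda>(x, y). pt x y) \<in> borel_measurable borel"
  unfolding case_prod_beta by (intro borel_measurable_continuous_onI continuous_intros)

text \<open>This is what lets Tonelli's theorem act in the variables (x1, y). A measure that agrees
  with Lebesgue measure on boxes is Lebesgue measure, and boxes factor into an interval and a planar
  box.\<close>

lemma lborel_eq_distr_pt: "lborel = distr (lborel \<Otimes>\<^sub>M lborel) borel (\<lambda>(x, y). pt x y)"
proof (rule lborel_eqI)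
  fix l u :: "real^3" assume le: "\<And>b. b \<in> Basis \<Longrightarrow> l \<bullet> b \<le> u \<bullet> b"
  have le': "l $ i \<le> u $ i" for i using le[of "axis i 1"] by (simp add: inner_axis)
  define l' u' :: "real^2" where "l' = vector [l $ 2, l $ 3]" and "u' = vector [u $ 2, u $ 3]"
  have 1: "(\<lambda>(x, y). pt x y) -` box l u = box (l $ 1) (u $ 1) \<times> box l' u'"
    by (auto simp: mem_box_cart forall_3 forall_2 l'_def u'_def)
  have "l' $ i \<le> u' $ i" for i
    using le' exhaust_2[of i] by (auto simp: l'_def u'_def)
  then have le2: "l' \<bullet> b \<le> u' \<bullet> b" if "b \<in> Basis" for b
    using that by (auto simp: Basis_vec_def inner_axis)
  have "emeasure (distr (lborel \<Otimes>\<^sub>M lborel) borel (\<lambda>(x, y). pt x y)) (box l u)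
      = emeasure (lborel \<Otimes>\<^sub>M lborel) (box (l $ 1) (u $ 1) \<times> box l' u')"
    using measurable_pt by (subst emeasure_distr) (auto simp: 1 lborel_prod)
  also have "\<dots> = emeasure lborel (box (l $ 1) (u $ 1)) * emeasure lborel (box l' u')"
    by (rule lborel.emeasure_pair_measure_Times) auto
  also have "\<dots> = ennreal (u $ 1 - l $ 1) * ennreal ((u $ 2 - l $ 2) * (u $ 3 - l $ 3))"
  proof -
    have "emeasure lborel (box l' u') = (\<Prod>b\<in>Basis. (u' - l') \<bullet> b)"
      by (rule emeasure_lborel_box) (rule le2)
    also have "\<dots> = ennreal ((u $ 2 - l $ 2) * (u $ 3 - l $ 3))"
      unfolding prod_Basis_vec by (simp add: UNIV_2 l'_def u'_def)
    finally have "emeasure lborel (box l' u') = ennreal ((u $ 2 - l $ 2) * (u $ 3 - l $ 3))" .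
    moreover have "emeasure lborel (box (l $ 1) (u $ 1)) = ennreal (u $ 1 - l $ 1)"
      using le'[of 1] by simp
    ultimately show ?thesis by simp
  qed
  also have "\<dots> = (\<Prod>b\<in>Basis. (u - l) \<bullet> b)"
  proof -
    have "(\<Prod>b\<in>Basis. (u - l) \<bullet> b) = (u $ 1 - l $ 1) * ((u $ 2 - l $ 2) * (u $ 3 - l $ 3))"
      unfolding prod_Basis_vec UNIV_3 by simp
    then show ?thesis using le'[of 1] le'[of 2] le'[of 3] by (simp only: ennreal_mult[symmetric] diff_ge_0_iff_ge mult_nonneg_nonneg)
  qed
  finally show "emeasure (distr (lborel \<Otimes>\<^sub>M lborel) borel (\<lambda>(x, y). pt x y)) (box l u)
      = ennreal (\<Prod>b\<in>Basis. (u - l) \<bullet> b)" .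
qed simp

lemma nn_integral_pt:
  assumes [measurable]: "f \<in> borel_measurable borel"
  shows "(\<integral>\<^sup>+ x. f x \<partial>lborel) = (\<integral>\<^sup>+ r. (\<integral>\<^sup>+ y. f (pt r y) \<partial>lborel) \<partial>lborel)"
proof -
  have m: "(\<lambda>(x, y). pt x y) \<in> lborel \<Otimes>\<^sub>M lborel \<rightarrow>\<^sub>M borel"
    using measurable_pt by (simp add: lborel_prod)
  have "(\<integral>\<^sup>+ x. f x \<partial>lborel) = (\<integral>\<^sup>+ z. f ((\<lambda>(x, y). pt x y) z) \<partial>(lborel \<Otimes>\<^sub>M lborel))"
    by (subst lborel_eq_distr_pt) (rule nn_integral_distr[OF m], simp)
  also have "\<dots> = (\<integral>\<^sup>+ r. (\<integral>\<^sup>+ y. f (pt r y) \<partial>lborel) \<partial>lborel)"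
    using measurable_compose[OF m assms] by (subst lborel.nn_integral_fst[symmetric]) simp_all
  finally show ?thesis .
qed

text \<open>After the shift by \<tau> t the factor \<open>a\<close> is bounded by \<open>A\<close>,
  which does not depend on t; by Tonelli the time integral then falls on \<open>b\<close> alone,
  where it is at most \<open>N\<close>.\<close>

lemma nn_integral_product_le:
  fixes a b :: "real \<Rightarrow> real \<Rightarrow> ennreal" and A :: "real \<Rightarrow> ennreal"
  assumes meas: "(\<lambda>(t, x). a t x) \<in> borel_measurable (borel \<Otimes>\<^sub>M borel)"
    "(\<lambda>(t, x). b t x) \<in> borel_measurable (borel \<Otimes>\<^sub>M borel)" "A \<in> borel_measurable borel"
    and a: "\<And>t x. t \<in> {0..T} \<Longrightarrow> a t (x + \<tau> * t) \<le> A x"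
    and b: "\<And>x. (\<integral>\<^sup>+ t\<in>{0..T}. b t (x + \<tau> * t) \<partial>lborel) \<le> N"
  shows "(\<integral>\<^sup>+ t\<in>{0..T}. (\<integral>\<^sup>+ x. a t x * b t x \<partial>lborel) \<partial>lborel) \<le> (\<integral>\<^sup>+ x. A x * N \<partial>lborel)"
proof -
  note [measurable] = meas
  have am: "(\<lambda>x. a t x) \<in> borel_measurable borel" "(\<lambda>x. b t x) \<in> borel_measurable borel" for t
    using measurable_compose[OF measurable_Pair1' meas(1), of t] measurable_compose[OF measurable_Pair1' meas(2), of t]
    by simp_all
  have bm: "(\<lambda>z. b (fst z) (snd z + \<tau> * fst z)) \<in> borel_measurable (borel \<Otimes>\<^sub>M borel)"
  proof -
    have "(\<lambda>z. (fst z, snd z + \<tau> * fst z)) \<in> borel \<Otimes>\<^sub>M borel \<rightarrow>\<^sub>M borel \<Otimes>\<^sub>M (borel :: real measure)"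
      by measurable
    from measurable_compose[OF this meas(2)] show ?thesis by simp
  qed
  have "(\<integral>\<^sup>+ t\<in>{0..T}. (\<integral>\<^sup>+ x. a t x * b t x \<partial>lborel) \<partial>lborel)
      = (\<integral>\<^sup>+ t\<in>{0..T}. (\<integral>\<^sup>+ x. a t (x + \<tau> * t) * b t (x + \<tau> * t) \<partial>lborel) \<partial>lborel)"
  proof (intro nn_integral_cong)
    fix t
    have "(\<lambda>x. a t x * b t x) \<in> borel_measurable borel" using am by simp
    from nn_integral_real_affine[OF this, of 1 "\<tau> * t"]
    show "(\<integral>\<^sup>+ x. a t x * b t x \<partial>lborel) * indicator {0..T} t
        = (\<integral>\<^sup>+ x. a t (x + \<tau> * t) * b t (x + \<tau> * t) \<partial>lborel) * indicator {0..T} t"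
      by (simp add: add.commute)
  qed
  also have "\<dots> \<le> (\<integral>\<^sup>+ t. (\<integral>\<^sup>+ x. A x * (b t (x + \<tau> * t) * indicator {0..T} t) \<partial>lborel) \<partial>lborel)"
  proof (intro nn_integral_mono)
    fix t
    show "(\<integral>\<^sup>+ x. a t (x + \<tau> * t) * b t (x + \<tau> * t) \<partial>lborel) * indicator {0..T} t
        \<le> (\<integral>\<^sup>+ x. A x * (b t (x + \<tau> * t) * indicator {0..T} t) \<partial>lborel)"
      using a by (cases "t \<in> {0..T}") (auto intro!: nn_integral_mono mult_right_mono)
  qed
  also have "\<dots> = (\<integral>\<^sup>+ x. (\<integral>\<^sup>+ t. A x * (b t (x + \<tau> * t) * indicator {0..T} t) \<partial>lborel) \<partial>lborel)"
    using bm by (intro lborel_pair.Fubini'[symmetric]) (auto simp: case_prod_beta)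
  also have "\<dots> = (\<integral>\<^sup>+ x. A x * (\<integral>\<^sup>+ t\<in>{0..T}. b t (x + \<tau> * t) \<partial>lborel) \<partial>lborel)"
  proof (intro nn_integral_cong nn_integral_cmult)
    fix x
    have "(\<lambda>t::real. (t, x :: real)) \<in> borel \<rightarrow>\<^sub>M borel \<Otimes>\<^sub>M borel" by simp
    from measurable_compose[OF this bm]
    show "(\<lambda>t. b t (x + \<tau> * t) * indicator {0..T} t) \<in> borel_measurable lborel" by simp
  qed
  also have "\<dots> \<le> (\<integral>\<^sup>+ x. A x * N \<partial>lborel)"
    by (intro nn_integral_mono mult_left_mono b) simp
  finally show ?thesis .
qed

section \<open>The Dirac equation in null components\<close>

lemma vector_4 [simp]:
  "(vector [a, b, c, d] :: 'a::zero^4) $ 1 = a"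
  "(vector [a, b, c, d] :: 'a::zero^4) $ 2 = b"
  "(vector [a, b, c, d] :: 'a::zero^4) $ 3 = c"
  "(vector [a, b, c, d] :: 'a::zero^4) $ 4 = d"
  unfolding vector_def by simp_all

lemma gamma0_mult_vec: "gamma0 *v w = vector [w $ 1, w $ 2, - w $ 3, - w $ 4]"
  by (simp add: vec_eq_iff forall_4 matrix_vector_mult_def sum_4 gamma0_def block_mat_def mat_def)

lemma gamma_mult_vec:
  "gamma 1 *v w = vector [w $ 4, w $ 3, - w $ 2, - w $ 1]"
  "gamma 2 *v w = vector [- \<i> * w $ 4, \<i> * w $ 3, \<i> * w $ 2, - \<i> * w $ 1]"
  "gamma 3 *v w = vector [w $ 3, - w $ 4, - w $ 1, w $ 2]"
  by (simp_all add: vec_eq_iff forall_4 matrix_vector_mult_def sum_4 gamma_def block_mat_def pauli_def)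

lemma alpha_mult_vec:
  "alpha 1 *v w = vector [w $ 4, w $ 3, w $ 2, w $ 1]"
  "alpha 2 *v w = vector [- \<i> * w $ 4, \<i> * w $ 3, - \<i> * w $ 2, \<i> * w $ 1]"
  "alpha 3 *v w = vector [w $ 3, - w $ 4, w $ 1, - w $ 2]"
  unfolding alpha_def matrix_vector_mul_assoc[symmetric] gamma_mult_vec gamma0_mult_vec
  by (simp_all add: vec_eq_iff forall_4)

text \<open>\<open>sig2\<close> and \<open>sig3\<close> are the matrices i \<sigma>^3 and -i
  \<sigma>^2, the coefficients of the two partial derivatives in \<open>D_y\<close>; both are
  unitary and anti-Hermitian.\<close>

definition sig2 :: "complex^2 \<Rightarrow> complex^2" where
  "sig2 z = vector [\<i> * z $ 1, - \<i> * z $ 2]"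

definition sig3 :: "complex^2 \<Rightarrow> complex^2" where
  "sig3 z = vector [- z $ 2, z $ 1]"

lemma bounded_linear_sig: "bounded_linear sig2" "bounded_linear sig3"
  unfolding linear_conv_bounded_linear[symmetric]
  by (auto intro!: linearI simp: sig2_def sig3_def vec_eq_iff forall_2 algebra_simps)

lemma norm_sig [simp]: "norm (sig2 z) = norm z" "norm (sig3 z) = norm z"
  by (simp_all add: sig2_def sig3_def norm_vec_def L2_set_def sum_2 norm_mult add.commute)

text \<open>The real inner product is the real part of the Hermitian one, so anti-Hermitian matrices
  are skew for it. With the sign from integration by parts this makes \<open>D_y\<close> formally
  self-adjoint, whereas the mass term below stays skew.\<close>

lemma inner_sig: "sig2 a \<bullet> b = - (a \<bullet> sig2 b)" "sig3 a \<bullet> b = - (a \<bullet> sig3 b)"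
  by (simp_all add: sig2_def sig3_def inner_vec_def sum_2 inner_complex_def)

lemma inner_imaginary: "((\<i> * complex_of_real m) *s a) \<bullet> b = - (a \<bullet> ((\<i> * complex_of_real m) *s b))"
  for a b :: "complex^2"
  by (simp add: inner_vec_def sum_2 inner_complex_def algebra_simps)

lemma C1_field_C1_fun:
  assumes "C1_field \<Phi>"
  shows "C1_fun (\<lambda>w. \<Phi> (fst w) (snd w))"
proof -
  obtain \<Phi>' :: "real \<times> (real^3) \<Rightarrow> (real \<times> (real^3)) \<Rightarrow>\<^sub>L (complex^4)" where
    d: "\<And>p. ((\<lambda>(t, x). \<Phi> t x) has_derivative blinfun_apply (\<Phi>' p)) (at p)" and c: "continuous_on UNIV \<Phi>'"
    using assms unfolding C1_field_def by blast
  show ?thesis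
  proof (rule C1_funI(1))
    show "((\<lambda>w. \<Phi> (fst w) (snd w)) has_derivative (\<lambda>v. blinfun_apply (\<Phi>' p) v)) (at p)" for p
      using d[of p] by (simp add: case_prod_unfold)
    show "continuous_on UNIV (\<lambda>p. blinfun_apply (\<Phi>' p) v)" for v
      using c by (intro continuous_intros)
  qed
qed

lemma vector_derivative_eq_dir_deriv:
  assumes "C1_fun (\<lambda>w. f (fst w) (snd w))"
  shows "vector_derivative (\<lambda>s. f s x) (at t) = dir_deriv (1, 0) (\<lambda>w. f (fst w) (snd w)) (t, x)"
    and "pderiv_at j (f t) x = dir_deriv (0, axis j 1) (\<lambda>w. f (fst w) (snd w)) (t, x)"
  using dir_deriv_line[OF assms, of "(0, x)" "(1, 0)" t] dir_deriv_line[OF assms, of "(t, x)" "(0, axis j 1)" 0]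
  by (auto simp: pderiv_at_def intro: vector_derivative_at)

text \<open>\<open>alpha 1\<close> exchanges components 1 with 4 and 2 with 3, so U and V are, up to
  normalisation, the parts of the spinor in its eigenspaces for 1 and -1; hence the x1-derivative
  combines with the time derivative into a null derivative of each. \<open>alpha 2\<close>,
  \<open>alpha 3\<close> and \<open>beta\<close> anticommute with \<open>alpha 1\<close> and
  therefore couple U to V.\<close>

lemma dirac_components:
  assumes sol: "dirac_solution m \<Phi>"
  defines "U \<equiv> \<lambda>w. U_comp \<Phi> (fst w) (snd w)" and "V \<equiv> \<lambda>w. V_comp \<Phi> (fst w) (snd w)"
  shows "C1_fun U" "C1_fun V"
    and "D_ym m (V_comp \<Phi> (fst w)) (snd w)
      = sig2 (dir_deriv (0, e2) V w) + sig3 (dir_deriv (0, e3) V w) + (\<i> * complex_of_real m) *s V w"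
    and "dir_deriv (1, e1) U w
      = - (sig2 (dir_deriv (0, e2) V w) + sig3 (dir_deriv (0, e3) V w) + (\<i> * complex_of_real m) *s V w)"
    and "dir_deriv (1, - e1) V w
      = sig2 (dir_deriv (0, e2) U w) + sig3 (dir_deriv (0, e3) U w) - (\<i> * complex_of_real m) *s U w"
proof -
  let ?F = "\<lambda>w. \<Phi> (fst w) (snd w)"
  define LU LV :: "complex^4 \<Rightarrow> complex^2" where "LU z = vector [z $ 1 + z $ 4, z $ 2 + z $ 3]"
    and "LV z = vector [z $ 1 - z $ 4, z $ 2 - z $ 3]" for z
  have F: "C1_fun ?F" using sol by (simp add: dirac_solution_def C1_field_C1_fun)
  have L: "bounded_linear LU" "bounded_linear LV"
    unfolding linear_conv_bounded_linear[symmetric]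
    by (auto intro!: linearI simp: LU_def LV_def vec_eq_iff forall_2 algebra_simps)
  have eq: "U = (\<lambda>w. LU (?F w))" "V = (\<lambda>w. LV (?F w))"
    by (auto simp: U_def V_def U_comp_def V_comp_def LU_def LV_def)
  show C1: "C1_fun U" "C1_fun V"
    unfolding eq by (rule C1_fun_bounded_linear(1)[OF L(1) F] C1_fun_bounded_linear(1)[OF L(2) F])+
  have dU: "dir_deriv v U w = LU (dir_deriv v ?F w)" and dV: "dir_deriv v V w = LV (dir_deriv v ?F w)" for v
    unfolding eq by (rule C1_fun_bounded_linear(2)[OF L(1) F] C1_fun_bounded_linear(2)[OF L(2) F])+
  show "D_ym m (V_comp \<Phi> (fst w)) (snd w)
      = sig2 (dir_deriv (0, e2) V w) + sig3 (dir_deriv (0, e3) V w) + (\<i> * complex_of_real m) *s V w"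
    using vector_derivative_eq_dir_deriv(2)[of "V_comp \<Phi>" _ "fst w" "snd w"] C1
    by (simp add: D_ym_def D_y_def V_def sig2_def sig3_def vec_eq_iff forall_2)
  define a b1 b2 b3 z where "a = dir_deriv (1, 0) ?F w" and "b1 = dir_deriv (0, e1) ?F w"
    and "b2 = dir_deriv (0, e2) ?F w" and "b3 = dir_deriv (0, e3) ?F w" and "z = ?F w"
  have "\<i> *s a = alpha 1 *v (- \<i> *s b1) + alpha 2 *v (- \<i> *s b2) + alpha 3 *v (- \<i> *s b3)
      + complex_of_real m *s (beta *v z)"
  proof -
    have "\<i> *s vector_derivative (\<lambda>s. \<Phi> s (snd w)) (at (fst w))
      = alpha_D (\<Phi> (fst w)) (snd w) + complex_of_real m *s (beta *v \<Phi> (fst w) (snd w))"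
      using sol by (simp add: dirac_solution_def)
    then show ?thesis
      unfolding alpha_D_def sum_3 vector_derivative_eq_dir_deriv[OF F] a_def b1_def b2_def b3_def z_def
      by simp
  qed
  then have "- \<i> * (\<i> * a $ k) = - \<i> * ((alpha 1 *v (- \<i> *s b1) + alpha 2 *v (- \<i> *s b2) + alpha 3 *v (- \<i> *s b3)
      + complex_of_real m *s (beta *v z)) $ k)" for k
    by (metis vector_smult_component)
  then have a: "a $ k = - \<i> * ((alpha 1 *v (- \<i> *s b1) + alpha 2 *v (- \<i> *s b2) + alpha 3 *v (- \<i> *s b3)
      + complex_of_real m *s (beta *v z)) $ k)" for k
    by simp
  have a1: "a $ 1 = - b1 $ 4 + \<i> * b2 $ 4 - b3 $ 3 - \<i> * m * z $ 1"
    and a2: "a $ 2 = - b1 $ 3 - \<i> * b2 $ 3 + b3 $ 4 - \<i> * m * z $ 2"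
    and a3: "a $ 3 = - b1 $ 2 + \<i> * b2 $ 2 - b3 $ 1 + \<i> * m * z $ 3"
    and a4: "a $ 4 = - b1 $ 1 - \<i> * b2 $ 1 + b3 $ 2 + \<i> * m * z $ 4"
    unfolding a[of 1] a[of 2] a[of 3] a[of 4] alpha_mult_vec beta_def gamma0_mult_vec
    by (simp_all add: algebra_simps)
  have s: "dir_deriv (1, e1) ?F w = a + b1" "dir_deriv (1, - e1) ?F w = a - b1"
    using dir_deriv_sum_scale[OF F, of 1 "(1, 0)" 1 "(0, e1)" w] dir_deriv_sum_scale[OF F, of 1 "(1, 0)" "-1" "(0, e1)" w]
    by (simp_all add: a_def b1_def)
  have w: "U w = LU z" "V w = LV z" by (simp_all add: eq z_def)
  show "dir_deriv (1, e1) U w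
      = - (sig2 (dir_deriv (0, e2) V w) + sig3 (dir_deriv (0, e3) V w) + (\<i> * complex_of_real m) *s V w)"
    unfolding dU dV s w b2_def[symmetric] b3_def[symmetric]
    by (simp add: LU_def LV_def sig2_def sig3_def vec_eq_iff forall_2 a1 a2 a3 a4 algebra_simps)
  show "dir_deriv (1, - e1) V w
      = sig2 (dir_deriv (0, e2) U w) + sig3 (dir_deriv (0, e3) U w) - (\<i> * complex_of_real m) *s U w"
    unfolding dU dV s w b2_def[symmetric] b3_def[symmetric]
    by (simp add: LU_def LV_def sig2_def sig3_def vec_eq_iff forall_2 a1 a2 a3 a4 algebra_simps)
qed

text \<open>The currents are twice the inner products of U with \<open>sig2 V\<close> and
  \<open>sig3 V\<close>. By skewness their divergence trades the transverse derivatives of U in the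
  equation for V against derivatives of V, so the two sources become opposite. The laws are used
  separately for transport, and their sum is the conservation of charge.\<close>

lemma dirac_conservation:
  assumes sol: "dirac_solution m \<Phi>"
  defines "U \<equiv> \<lambda>w. U_comp \<Phi> (fst w) (snd w)" and "V \<equiv> \<lambda>w. V_comp \<Phi> (fst w) (snd w)"
    and "DV \<equiv> \<lambda>w. D_ym m (V_comp \<Phi> (fst w)) (snd w)"
  obtains Q2 Q3 :: "real \<times> (real^3) \<Rightarrow> real"
  where "C1_fun (\<lambda>w. (norm (U w))\<^sup>2)" "C1_fun (\<lambda>w. (norm (V w))\<^sup>2)" "C1_fun Q2" "C1_fun Q3"
    and "\<And>w. \<bar>Q2 w\<bar> \<le> (norm (U w))\<^sup>2 + (norm (V w))\<^sup>2" "\<And>w. \<bar>Q3 w\<bar> \<le> (norm (U w))\<^sup>2 + (norm (V w))\<^sup>2"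
    and "\<And>w. dir_deriv (1, e1) (\<lambda>w. (norm (U w))\<^sup>2) w = - 2 * (U w \<bullet> DV w)"
    and "\<And>w. dir_deriv (1, - e1) (\<lambda>w. (norm (V w))\<^sup>2) w + dir_deriv (0, e2) Q2 w + dir_deriv (0, e3) Q3 w
        = 2 * (U w \<bullet> DV w)"
proof -
  have app: "U_comp \<Phi> (fst w) (snd w) = U w" "V_comp \<Phi> (fst w) (snd w) = V w"
    "D_ym m (V_comp \<Phi> (fst w)) (snd w) = DV w" for w
    by (simp_all add: U_def V_def DV_def)
  note d = dirac_components[OF sol, unfolded app]
  let ?Q2 = "\<lambda>w. (2 *\<^sub>R U w) \<bullet> sig2 (V w)" and ?Q3 = "\<lambda>w. (2 *\<^sub>R U w) \<bullet> sig3 (V w)"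
  note U2 = C1_fun_bounded_linear[OF bounded_linear_scaleR_right[of 2] d(1)]
  note V2 = C1_fun_bounded_linear[OF bounded_linear_sig(1) d(2)]
  note V3 = C1_fun_bounded_linear[OF bounded_linear_sig(2) d(2)]
  have Q: "\<bar>(2 *\<^sub>R U w) \<bullet> z\<bar> \<le> (norm (U w))\<^sup>2 + (norm (V w))\<^sup>2" if "norm z = norm (V w)" for w z
    using Cauchy_Schwarz_ineq2[of "2 *\<^sub>R U w" z] sum_squares_bound[of "norm (U w)" "norm (V w)"] that
    by simp
  show ?thesis
  proof (rule that[of ?Q2 ?Q3])
    show "C1_fun (\<lambda>w. (norm (U w))\<^sup>2)" "C1_fun (\<lambda>w. (norm (V w))\<^sup>2)"
      unfolding power2_norm_eq_inner by (rule C1_fun_inner(1)[OF d(1) d(1)] C1_fun_inner(1)[OF d(2) d(2)])+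
    show "C1_fun ?Q2" "C1_fun ?Q3"
      by (rule C1_fun_inner(1)[OF U2(1) V2(1)] C1_fun_inner(1)[OF U2(1) V3(1)])+
    show "\<bar>?Q2 w\<bar> \<le> (norm (U w))\<^sup>2 + (norm (V w))\<^sup>2" "\<bar>?Q3 w\<bar> \<le> (norm (U w))\<^sup>2 + (norm (V w))\<^sup>2" for w
      by (rule Q, simp)+
    show "dir_deriv (1, e1) (\<lambda>w. (norm (U w))\<^sup>2) w = - 2 * (U w \<bullet> DV w)" for w
    proof -
      have "dir_deriv (1, e1) U w = - DV w" by (simp only: d(3,4))
      then show ?thesis
        unfolding power2_norm_eq_inner C1_fun_inner(2)[OF d(1) d(1)] by (simp add: inner_commute)
    qed
    show "dir_deriv (1, - e1) (\<lambda>w. (norm (V w))\<^sup>2) w + dir_deriv (0, e2) ?Q2 w + dir_deriv (0, e3) ?Q3 w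
        = 2 * (U w \<bullet> DV w)" for w
    proof -
      define z where "z = (\<i> * complex_of_real m) *s U w"
      have "z \<bullet> V w = - (U w \<bullet> ((\<i> * complex_of_real m) *s V w))"
        unfolding z_def by (rule inner_imaginary)
      then show ?thesis
        unfolding power2_norm_eq_inner C1_fun_inner(2)[OF d(2) d(2)] C1_fun_inner(2)[OF U2(1) V2(1)]
          C1_fun_inner(2)[OF U2(1) V3(1)] U2(2) V2(2) V3(2) d(5) d(3)[of w] z_def[symmetric]
        using inner_sig(1)[of "dir_deriv (0, e2) U w" "V w"] inner_sig(2)[of "dir_deriv (0, e3) U w" "V w"]
        by (simp add: inner_commute[of "V w"] inner_add_left inner_add_right inner_diff_left)
    qed
  qed
qed

lemma continuous_on_dirac_pairing:
  assumes sol: "dirac_solution m \<Phi>"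
  shows "continuous_on UNIV (\<lambda>w. norm (D_ym m (V_comp \<Phi> (fst w)) (snd w)) * norm (U_comp \<Phi> (fst w) (snd w)))"
proof -
  define V where "V w = V_comp \<Phi> (fst w) (snd w)" for w
  have app: "V_comp \<Phi> (fst w) (snd w) = V w" for w by (simp add: V_def)
  note d = dirac_components[OF sol, unfolded app]
  have "continuous_on UNIV (\<lambda>w. (\<i> * complex_of_real m) *s V w)"
    unfolding vector_scalar_mult_def
    by (intro continuous_intros continuous_on_C1_fun[OF d(2)])
  then show ?thesis
    unfolding d(3)
    by (auto intro!: continuous_on_mult continuous_on_norm continuous_on_add continuous_on_C1_fun[OF d(1)]
      bounded_linear.continuous_on[OF bounded_linear_sig(1)] bounded_linear.continuous_on[OF bounded_linear_sig(2)]
      continuous_on_dir_deriv[OF d(2)] continuous_on_id)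
qed

section \<open>Null-plane estimates for a Dirac solution\<close>

lemma trans_density_pt: "trans_density W t x = (\<integral>\<^sup>+ y. ennreal ((norm (W t (pt x y)))\<^sup>2) \<partial>lborel)"
  by (simp add: trans_density_def pt_def)

text \<open>For each fixed s the shift by \<tau> s preserves measure, so the null planes of one
  family sweep every time slice exactly once.\<close>

lemma nn_integral_characteristics:
  fixes F :: "real \<times> (real^3) \<Rightarrow> real"
  assumes F: "continuous_on UNIV F"
  shows "(\<integral>\<^sup>+ x. (\<integral>\<^sup>+ s\<in>{0..T}. (\<integral>\<^sup>+ y. ennreal (F (s, pt (x + \<tau> * s) y)) \<partial>lborel) \<partial>lborel) \<partial>lborel)
    = (\<integral>\<^sup>+ s\<in>{0..T}. (\<integral>\<^sup>+ x. ennreal (F (s, x)) \<partial>lborel) \<partial>lborel)"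
    and "(\<lambda>x. \<integral>\<^sup>+ s\<in>{0..T}. (\<integral>\<^sup>+ y. ennreal (F (s, pt (x + \<tau> * s) y)) \<partial>lborel) \<partial>lborel) \<in> borel_measurable borel"
proof -
  let ?g = "\<lambda>s x. \<integral>\<^sup>+ y. ennreal (F (s, pt x y)) \<partial>lborel"
  have g: "(\<lambda>z. ?g (fst z) (snd z)) \<in> borel_measurable (borel \<Otimes>\<^sub>M borel)"
    using borel_measurable_nn_integral_pt[OF F] by (simp add: case_prod_beta)
  have "(\<lambda>z. (fst z, snd z + \<tau> * fst z)) \<in> borel \<Otimes>\<^sub>M borel \<rightarrow>\<^sub>M borel \<Otimes>\<^sub>M (borel :: real measure)"
    by measurable
  from measurable_compose[OF this g]
  have gs: "(\<lambda>z. ?g (fst z) (snd z + \<tau> * fst z)) \<in> borel_measurable (borel \<Otimes>\<^sub>M borel)" by simp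
  have "(\<lambda>z. (snd z, fst z)) \<in> borel \<Otimes>\<^sub>M borel \<rightarrow>\<^sub>M borel \<Otimes>\<^sub>M (borel :: real measure)"
    by measurable
  from measurable_compose[OF this gs]
  have gs': "(\<lambda>z. ?g (snd z) (fst z + \<tau> * snd z)) \<in> borel_measurable ((borel :: real measure) \<Otimes>\<^sub>M borel)" by simp
  have ind: "(\<lambda>z. ?g (snd z) (fst z + \<tau> * snd z) * indicator {0..T} (snd z))
      \<in> borel_measurable ((borel :: real measure) \<Otimes>\<^sub>M lborel)"
    using gs' by simp
  then show "(\<lambda>x. \<integral>\<^sup>+ s\<in>{0..T}. ?g s (x + \<tau> * s) \<partial>lborel) \<in> borel_measurable borel"
    by (intro lborel.borel_measurable_nn_integral) (simp add: case_prod_beta)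
  have "(\<integral>\<^sup>+ x. (\<integral>\<^sup>+ s\<in>{0..T}. ?g s (x + \<tau> * s) \<partial>lborel) \<partial>lborel)
      = (\<integral>\<^sup>+ s. (\<integral>\<^sup>+ x. ?g s (x + \<tau> * s) * indicator {0..T} s \<partial>lborel) \<partial>lborel)"
    using gs by (intro lborel_pair.Fubini') (simp add: case_prod_beta)
  also have "\<dots> = (\<integral>\<^sup>+ s\<in>{0..T}. (\<integral>\<^sup>+ x. ennreal (F (s, x)) \<partial>lborel) \<partial>lborel)"
  proof (intro nn_integral_cong)
    fix s
    have "(\<lambda>x. (s, x)) \<in> (borel :: real measure) \<rightarrow>\<^sub>M (borel :: real measure) \<Otimes>\<^sub>M (borel :: real measure)" by simp
    from measurable_compose[OF this g] have gm: "?g s \<in> borel_measurable borel" by simp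
    have "(\<lambda>x. (s, x + \<tau> * s)) \<in> borel \<rightarrow>\<^sub>M (borel :: real measure) \<Otimes>\<^sub>M (borel :: real measure)" by simp
    from measurable_compose[OF this g] have gm': "(\<lambda>x. ?g s (x + \<tau> * s)) \<in> borel_measurable borel" by simp
    have "(\<integral>\<^sup>+ x. ?g s (x + \<tau> * s) * indicator {0..T} s \<partial>lborel) = (\<integral>\<^sup>+ x. ?g s (x + \<tau> * s) \<partial>lborel) * indicator {0..T} s"
      using gm' by (intro nn_integral_multc) simp
    also have "(\<integral>\<^sup>+ x. ?g s (x + \<tau> * s) \<partial>lborel) = (\<integral>\<^sup>+ x. ?g s x \<partial>lborel)"
      using nn_integral_real_affine[OF gm, of 1 "\<tau> * s"] by (simp add: add.commute)
    also have "\<dots> = (\<integral>\<^sup>+ x. ennreal (F (s, x)) \<partial>lborel)"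
    proof (rule nn_integral_pt[symmetric])
      show "(\<lambda>x. ennreal (F (s, x))) \<in> borel_measurable borel"
        by (intro borel_measurable_continuous_onI continuous_on_ennreal continuous_on_compose2[OF F])
          (auto intro!: continuous_intros)
    qed
    finally show "(\<integral>\<^sup>+ x. ?g s (x + \<tau> * s) * indicator {0..T} s \<partial>lborel)
        = (\<integral>\<^sup>+ x. ennreal (F (s, x)) \<partial>lborel) * indicator {0..T} s" .
  qed
  finally show "(\<integral>\<^sup>+ x. (\<integral>\<^sup>+ s\<in>{0..T}. ?g s (x + \<tau> * s) \<partial>lborel) \<partial>lborel)
      = (\<integral>\<^sup>+ s\<in>{0..T}. (\<integral>\<^sup>+ x. ennreal (F (s, x)) \<partial>lborel) \<partial>lborel)" .
qed

text \<open>Both identities rest on the parallelogram law, applied to components 1 and 4 and to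
  components 2 and 3 of the spinor.\<close>

lemma trans_density_initial:
  assumes sol: "dirac_solution m \<Phi>"
  shows "(\<integral>\<^sup>+ r. trans_density (U_comp \<Phi>) 0 r \<partial>lborel) + (\<integral>\<^sup>+ r. trans_density (V_comp \<Phi>) 0 r \<partial>lborel)
      = 2 * L2_norm_sq (\<Phi> 0)"
    and "(\<integral>\<^sup>+ r. (\<integral>\<^sup>+ y. ennreal ((norm (U_comp \<Phi> 0 (pt r y)))\<^sup>2 + (norm (V_comp \<Phi> 0 (pt r y)))\<^sup>2) \<partial>lborel) \<partial>lborel)
      = 2 * L2_norm_sq (\<Phi> 0)"
proof -
  note d = dirac_components(1,2)[OF sol]
  have m: "(\<lambda>x. ennreal ((norm (W (0::real, x)))\<^sup>2)) \<in> borel_measurable borel"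
    if "C1_fun W" for W :: "real \<times> (real^3) \<Rightarrow> 'b::real_normed_vector"
    by (intro borel_measurable_continuous_onI continuous_on_ennreal continuous_on_power continuous_on_norm
        continuous_on_C1_fun[OF that] continuous_intros)
  note mU = m[OF d(1), unfolded fst_conv snd_conv] and mV = m[OF d(2), unfolded fst_conv snd_conv]
  have "C1_fun (\<lambda>w. \<Phi> (fst w) (snd w))" using sol by (simp add: dirac_solution_def C1_field_C1_fun)
  note m\<Phi> = m[OF this, unfolded fst_conv snd_conv]
  have parallelogram: "(norm (U_comp \<Phi> 0 x))\<^sup>2 + (norm (V_comp \<Phi> 0 x))\<^sup>2 = 2 * (norm (\<Phi> 0 x))\<^sup>2" for x
    by (simp add: power2_norm_eq_inner inner_vec_def sum_2 sum_4 U_comp_def V_comp_def inner_complex_def algebra_simps)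
  have "(\<integral>\<^sup>+ x. ennreal ((norm (U_comp \<Phi> 0 x))\<^sup>2 + (norm (V_comp \<Phi> 0 x))\<^sup>2) \<partial>lborel) = 2 * L2_norm_sq (\<Phi> 0)"
    unfolding parallelogram L2_norm_sq_def using m\<Phi> by (simp add: ennreal_mult nn_integral_cmult)
  moreover have "(\<lambda>x. ennreal ((norm (U_comp \<Phi> 0 x))\<^sup>2 + (norm (V_comp \<Phi> 0 x))\<^sup>2)) \<in> borel_measurable borel"
    using mU mV by (simp add: ennreal_plus)
  ultimately show 2: "(\<integral>\<^sup>+ r. (\<integral>\<^sup>+ y. ennreal ((norm (U_comp \<Phi> 0 (pt r y)))\<^sup>2 + (norm (V_comp \<Phi> 0 (pt r y)))\<^sup>2) \<partial>lborel) \<partial>lborel)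
      = 2 * L2_norm_sq (\<Phi> 0)"
    by (simp only: nn_integral_pt)
  have "(\<integral>\<^sup>+ r. trans_density (U_comp \<Phi>) 0 r \<partial>lborel) + (\<integral>\<^sup>+ r. trans_density (V_comp \<Phi>) 0 r \<partial>lborel)
      = (\<integral>\<^sup>+ x. ennreal ((norm (U_comp \<Phi> 0 x))\<^sup>2) \<partial>lborel) + (\<integral>\<^sup>+ x. ennreal ((norm (V_comp \<Phi> 0 x))\<^sup>2) \<partial>lborel)"
    unfolding trans_density_pt nn_integral_pt[OF mU] nn_integral_pt[OF mV] ..
  also have "\<dots> = (\<integral>\<^sup>+ x. ennreal ((norm (U_comp \<Phi> 0 x))\<^sup>2 + (norm (V_comp \<Phi> 0 x))\<^sup>2) \<partial>lborel)"
    using mU mV by (simp add: ennreal_plus nn_integral_add)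
  also have "\<dots> = 2 * L2_norm_sq (\<Phi> 0)" by fact
  finally show "(\<integral>\<^sup>+ r. trans_density (U_comp \<Phi>) 0 r \<partial>lborel) + (\<integral>\<^sup>+ r. trans_density (V_comp \<Phi>) 0 r \<partial>lborel)
      = 2 * L2_norm_sq (\<Phi> 0)" .
qed

text \<open>The relative speed 2 in \<open>flux_bound\<close> cancels the 2 of the parallelogram
  law, which leaves the constant 1. The second bound is the mirror image of the first: U and V
  change places and \<tau> changes sign.\<close>

lemma dirac_flux:
  assumes sol: "dirac_solution m \<Phi>" and T: "0 \<le> T"
  shows "(\<integral>\<^sup>+ t\<in>{0..T}. trans_density (V_comp \<Phi>) t (x + 1 * t) \<partial>lborel) \<le> L2_norm_sq (\<Phi> 0)"
    and "(\<integral>\<^sup>+ t\<in>{0..T}. trans_density (U_comp \<Phi>) t (x + (- 1) * t) \<partial>lborel) \<le> L2_norm_sq (\<Phi> 0)"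
proof -
  obtain Q2 Q3 where c: "C1_fun (\<lambda>w. (norm (U_comp \<Phi> (fst w) (snd w)))\<^sup>2)" "C1_fun (\<lambda>w. (norm (V_comp \<Phi> (fst w) (snd w)))\<^sup>2)"
      "C1_fun Q2" "C1_fun Q3"
    and Q: "\<And>w. \<bar>Q2 w\<bar> \<le> (norm (U_comp \<Phi> (fst w) (snd w)))\<^sup>2 + (norm (V_comp \<Phi> (fst w) (snd w)))\<^sup>2"
      "\<And>w. \<bar>Q3 w\<bar> \<le> (norm (U_comp \<Phi> (fst w) (snd w)))\<^sup>2 + (norm (V_comp \<Phi> (fst w) (snd w)))\<^sup>2"
    and eqU: "\<And>w. dir_deriv (1, e1) (\<lambda>w. (norm (U_comp \<Phi> (fst w) (snd w)))\<^sup>2) w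
      = - 2 * (U_comp \<Phi> (fst w) (snd w) \<bullet> D_ym m (V_comp \<Phi> (fst w)) (snd w))"
    and eqV: "\<And>w. dir_deriv (1, - e1) (\<lambda>w. (norm (V_comp \<Phi> (fst w) (snd w)))\<^sup>2) w + dir_deriv (0, e2) Q2 w + dir_deriv (0, e3) Q3 w
        = 2 * (U_comp \<Phi> (fst w) (snd w) \<bullet> D_ym m (V_comp \<Phi> (fst w)) (snd w))"
    by (rule dirac_conservation[OF sol]) (rule that)
  have half: "a \<le> b" if "2 * a \<le> 2 * b" for a b :: ennreal
    using divide_right_mono_ennreal[OF that, of 2] by (simp only: two_mult_divide_ennreal)
  have "2 * (\<integral>\<^sup>+ t\<in>{0..T}. trans_density (V_comp \<Phi>) t (x + 1 * t) \<partial>lborel) \<le> 2 * L2_norm_sq (\<Phi> 0)"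
  proof -
    have eq: "dir_deriv (1, 1 *\<^sub>R e1) (\<lambda>w. (norm (U_comp \<Phi> (fst w) (snd w)))\<^sup>2) w
        + dir_deriv (1, - 1 *\<^sub>R e1) (\<lambda>w. (norm (V_comp \<Phi> (fst w) (snd w)))\<^sup>2) w
        + dir_deriv (0, e2) Q2 w + dir_deriv (0, e3) Q3 w = 0" for w
      using eqU[of w] eqV[of w] by simp
    show ?thesis
      using flux_bound[OF c(1,2,3,4) _ _ Q eq _ T, of x]
      by (simp add: trans_density_pt trans_density_initial(2)[OF sol] del: ennreal_plus)
  qed
  then show "(\<integral>\<^sup>+ t\<in>{0..T}. trans_density (V_comp \<Phi>) t (x + 1 * t) \<partial>lborel) \<le> L2_norm_sq (\<Phi> 0)"
    by (rule half)
  have "2 * (\<integral>\<^sup>+ t\<in>{0..T}. trans_density (U_comp \<Phi>) t (x + (- 1) * t) \<partial>lborel) \<le> 2 * L2_norm_sq (\<Phi> 0)"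
  proof -
    have "2 * (\<integral>\<^sup>+ t\<in>{0..T}. trans_density (U_comp \<Phi>) t (x + (- 1) * t) \<partial>lborel)
      \<le> (\<integral>\<^sup>+ r. (\<integral>\<^sup>+ y. ennreal ((norm (V_comp \<Phi> 0 (pt r y)))\<^sup>2 + (norm (U_comp \<Phi> 0 (pt r y)))\<^sup>2) \<partial>lborel) \<partial>lborel)"
    proof -
      have eq: "dir_deriv (1, (- 1) *\<^sub>R e1) (\<lambda>w. (norm (V_comp \<Phi> (fst w) (snd w)))\<^sup>2) w
          + dir_deriv (1, - (- 1) *\<^sub>R e1) (\<lambda>w. (norm (U_comp \<Phi> (fst w) (snd w)))\<^sup>2) w
          + dir_deriv (0, e2) Q2 w + dir_deriv (0, e3) Q3 w = 0" for w
        using eqU[of w] eqV[of w] by simp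
      note flux_bound[OF c(2,1,3,4) _ _ _ _ eq _ T, of x]
      then show ?thesis using Q by (simp add: trans_density_pt add.commute del: ennreal_plus)
    qed
    then show ?thesis
      using trans_density_initial(2)[OF sol] by (simp add: add.commute del: ennreal_plus)
  qed
  then show "(\<integral>\<^sup>+ t\<in>{0..T}. trans_density (U_comp \<Phi>) t (x + (- 1) * t) \<partial>lborel) \<le> L2_norm_sq (\<Phi> 0)"
    by (rule half)
qed

text \<open>|U|^2 has no transverse current, so \<open>transport_bound\<close> applies with zero
  \<open>p\<close>. For |V|^2 the current is bounded by |U|^2 + |V|^2, so \<open>p\<close> is |U|^2,
  whose integral over the plane x1 = x - t is the flux bounded in \<open>dirac_flux\<close>; finite
  charge makes it finite.\<close>

lemma dirac_transport:
  assumes sol: "dirac_solution m \<Phi>" and t: "t \<in> {0..T}"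
  defines "G \<equiv> \<lambda>w. norm (D_ym m (V_comp \<Phi> (fst w)) (snd w)) * norm (U_comp \<Phi> (fst w) (snd w))"
  shows "trans_density (U_comp \<Phi>) t (x + 1 * t) \<le> trans_density (U_comp \<Phi>) 0 x
      + (\<integral>\<^sup>+ s\<in>{0..T}. (\<integral>\<^sup>+ y. ennreal (2 * G (s, pt (x + 1 * s) y)) \<partial>lborel) \<partial>lborel)"
    and "L2_norm_sq (\<Phi> 0) < \<infinity> \<Longrightarrow> trans_density (V_comp \<Phi>) t (x + (- 1) * t) \<le> trans_density (V_comp \<Phi>) 0 x
      + (\<integral>\<^sup>+ s\<in>{0..T}. (\<integral>\<^sup>+ y. ennreal (2 * G (s, pt (x + (- 1) * s) y)) \<partial>lborel) \<partial>lborel)"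
proof -
  obtain Q2 Q3 where c: "C1_fun (\<lambda>w. (norm (U_comp \<Phi> (fst w) (snd w)))\<^sup>2)" "C1_fun (\<lambda>w. (norm (V_comp \<Phi> (fst w) (snd w)))\<^sup>2)"
      "C1_fun Q2" "C1_fun Q3"
    and Q: "\<And>w. \<bar>Q2 w\<bar> \<le> (norm (U_comp \<Phi> (fst w) (snd w)))\<^sup>2 + (norm (V_comp \<Phi> (fst w) (snd w)))\<^sup>2"
      "\<And>w. \<bar>Q3 w\<bar> \<le> (norm (U_comp \<Phi> (fst w) (snd w)))\<^sup>2 + (norm (V_comp \<Phi> (fst w) (snd w)))\<^sup>2"
    and eqU: "\<And>w. dir_deriv (1, e1) (\<lambda>w. (norm (U_comp \<Phi> (fst w) (snd w)))\<^sup>2) w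
      = - 2 * (U_comp \<Phi> (fst w) (snd w) \<bullet> D_ym m (V_comp \<Phi> (fst w)) (snd w))"
    and eqV: "\<And>w. dir_deriv (1, - e1) (\<lambda>w. (norm (V_comp \<Phi> (fst w) (snd w)))\<^sup>2) w + dir_deriv (0, e2) Q2 w + dir_deriv (0, e3) Q3 w
        = 2 * (U_comp \<Phi> (fst w) (snd w) \<bullet> D_ym m (V_comp \<Phi> (fst w)) (snd w))"
    by (rule dirac_conservation[OF sol]) (rule that)
  have Gc: "continuous_on UNIV G"
    unfolding G_def by (rule continuous_on_dirac_pairing[OF sol])
  have G2: "continuous_on UNIV (\<lambda>w. 2 * G w)" by (intro continuous_intros Gc)
  have G0: "0 \<le> G w" for w by (simp add: G_def)
  have CS: "\<bar>U_comp \<Phi> (fst w) (snd w) \<bullet> D_ym m (V_comp \<Phi> (fst w)) (snd w)\<bar> \<le> G w" for w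
    using Cauchy_Schwarz_ineq2[of "U_comp \<Phi> (fst w) (snd w)" "D_ym m (V_comp \<Phi> (fst w)) (snd w)"]
    by (simp add: G_def mult.commute)
  have zero: "C1_fun (\<lambda>w::real \<times> (real^3). 0::real)" "dir_deriv v (\<lambda>w::real \<times> (real^3). 0::real) w = 0" for v w
    by (rule C1_funI[where f' = "\<lambda>_ _. 0"]; simp)+
  show "trans_density (U_comp \<Phi>) t (x + 1 * t) \<le> trans_density (U_comp \<Phi>) 0 x
      + (\<integral>\<^sup>+ s\<in>{0..T}. (\<integral>\<^sup>+ y. ennreal (2 * G (s, pt (x + 1 * s) y)) \<partial>lborel) \<partial>lborel)"
  proof -
    have "dir_deriv (1, 1 *\<^sub>R e1) (\<lambda>w. (norm (U_comp \<Phi> (fst w) (snd w)))\<^sup>2) w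
        + dir_deriv (0, e2) (\<lambda>_. 0) w + dir_deriv (0, e3) (\<lambda>_. 0) w \<le> 2 * G w" for w
      using eqU[of w] CS[of w] by (simp add: zero abs_le_iff)
    from transport_bound[OF c(1) zero(1) zero(1) _ G2 _ _ _ _ _ this, of "\<lambda>_. 0" x T t] t
    show ?thesis by (simp add: trans_density_pt G0)
  qed
  assume fin: "L2_norm_sq (\<Phi> 0) < \<infinity>"
  show "trans_density (V_comp \<Phi>) t (x + (- 1) * t) \<le> trans_density (V_comp \<Phi>) 0 x
      + (\<integral>\<^sup>+ s\<in>{0..T}. (\<integral>\<^sup>+ y. ennreal (2 * G (s, pt (x + (- 1) * s) y)) \<partial>lborel) \<partial>lborel)"
  proof -
    have le: "dir_deriv (1, (- 1) *\<^sub>R e1) (\<lambda>w. (norm (V_comp \<Phi> (fst w) (snd w)))\<^sup>2) w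
        + dir_deriv (0, e2) Q2 w + dir_deriv (0, e3) Q3 w \<le> 2 * G w" for w
      using eqV[of w] CS[of w] by (simp add: abs_le_iff)
    have "(\<integral>\<^sup>+ s\<in>{0..T}. (\<integral>\<^sup>+ y. ennreal ((norm (U_comp \<Phi> s (pt (x + (- 1) * s) y)))\<^sup>2) \<partial>lborel) \<partial>lborel) < \<infinity>"
      using dirac_flux(2)[OF sol, of T x] t fin by (auto simp: trans_density_pt intro: le_less_trans)
    then show ?thesis
      using transport_bound[OF c(2,3,4) continuous_on_C1_fun[OF c(1) continuous_on_id] G2 _ _ _ Q le, of x T t] t
      by (simp add: trans_density_pt G0)
  qed
qed

section \<open>The bilinear estimate, from both families of null planes\<close>

theorem lemma2p3:
  "\<exists>C::real. C > 0 \<and>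
    (\<forall>(m::real) (T::real) (\<Phi> :: real \<Rightarrow> real^3 \<Rightarrow> complex^4) (\<Psi> :: real \<Rightarrow> real^3 \<Rightarrow> complex^4).
      m \<ge> 0 \<longrightarrow> T > 0 \<longrightarrow>
      dirac_solution m \<Phi> \<longrightarrow> schwartz (\<Phi> 0) \<longrightarrow>
      dirac_solution m \<Psi> \<longrightarrow> schwartz (\<Psi> 0) \<longrightarrow>
      (\<integral>\<^sup>+ t\<in>{0..T}. (\<integral>\<^sup>+ x1.
          (trans_density (U_comp \<Phi>) t x1 * trans_density (V_comp \<Psi>) t x1
         + trans_density (V_comp \<Phi>) t x1 * trans_density (U_comp \<Psi>) t x1)
         \<partial>lborel) \<partial>lborel)
      \<le> ennreal C * L2_norm_sq (\<Psi> 0) *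
          (L2_norm_sq (\<Phi> 0) +
           (\<integral>\<^sup>+ t\<in>{0..T}. (\<integral>\<^sup>+ x.
              ennreal (norm (D_ym m (V_comp \<Phi> t) x) * norm (U_comp \<Phi> t x))
             \<partial>lborel) \<partial>lborel)))"
proof (intro exI[of _ 4] conjI allI impI)
  fix m T :: real and \<Phi> \<Psi> :: "real \<Rightarrow> real^3 \<Rightarrow> complex^4"
  assume T: "T > 0" and \<Phi>: "dirac_solution m \<Phi>" and \<Psi>: "dirac_solution m \<Psi>"
  define G where "G w = norm (D_ym m (V_comp \<Phi> (fst w)) (snd w)) * norm (U_comp \<Phi> (fst w) (snd w))" for w
  define L where "L = L2_norm_sq (\<Phi> 0)"
  define N where "N = L2_norm_sq (\<Psi> 0)"
  define J where "J = (\<integral>\<^sup>+ t\<in>{0..T}. (\<integral>\<^sup>+ x. ennreal (norm (D_ym m (V_comp \<Phi> t) x) * norm (U_comp \<Phi> t x)) \<partial>lborel) \<partial>lborel)"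
  let ?I = "\<lambda>a b. \<integral>\<^sup>+ t\<in>{0..T}. (\<integral>\<^sup>+ x. trans_density a t x * trans_density b t x \<partial>lborel) \<partial>lborel"
  have Gc: "continuous_on UNIV G"
    unfolding G_def by (rule continuous_on_dirac_pairing[OF \<Phi>])
  have meas: "(\<lambda>(t, x). trans_density W t x) \<in> borel_measurable (borel \<Otimes>\<^sub>M borel)"
    if "C1_fun (\<lambda>w. W (fst w) (snd w))" for W
    using borel_measurable_nn_integral_pt[of "\<lambda>w. (norm (W (fst w) (snd w)))\<^sup>2"] continuous_on_C1_fun[OF that continuous_on_id]
    by (simp add: trans_density_pt continuous_on_power continuous_on_norm)
  note mU = meas[OF dirac_components(1)[OF \<Phi>]] and mV = meas[OF dirac_components(2)[OF \<Phi>]]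
    and mU' = meas[OF dirac_components(1)[OF \<Psi>]] and mV' = meas[OF dirac_components(2)[OF \<Psi>]]
  note b = dirac_flux[OF \<Psi> less_imp_le[OF T], folded N_def]
  have "?I (U_comp \<Phi>) (V_comp \<Psi>) + ?I (V_comp \<Phi>) (U_comp \<Psi>) \<le> 4 * N * (L + J)"
  proof (cases "N = 0")
    \<comment> \<open>Here \<open>top * N = 0\<close> in \<^typ>\<open>ennreal\<close>, so the trivial bound \<open>A = top\<close> suffices, also when \<open>L\<close> is infinite.\<close>
    case True
    have "?I (U_comp \<Phi>) (V_comp \<Psi>) \<le> nn_integral lborel (\<lambda>x::real. top * N)"
      by (rule nn_integral_product_le[OF mU mV' _ _ b(1)]) auto
    moreover have "?I (V_comp \<Phi>) (U_comp \<Psi>) \<le> nn_integral lborel (\<lambda>x::real. top * N)"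
      by (rule nn_integral_product_le[OF mV mU' _ _ b(2)]) auto
    ultimately show ?thesis by (simp add: True)
  next
    case N: False
    show ?thesis
    \<comment> \<open>As \<open>N\<close> is not 0, an infinite \<open>L\<close> makes the
      right-hand side infinite; a finite one is what the transport of |V|^2 asks for.\<close>
    proof (cases "L = \<infinity>")
      case True
      then show ?thesis using N by (simp add: ennreal_mult_top)
    next
      case False
      then have fin: "L2_norm_sq (\<Phi> 0) < \<infinity>" by (simp add: L_def less_top)
      \<comment> \<open>This is the majorant, independent of t, that
        \<open>nn_integral_product_le\<close> asks for along the characteristic starting at
        x.\<close>
      define A where "A W \<tau> x = trans_density W 0 x
        + (\<integral>\<^sup>+ s\<in>{0..T}. (\<integral>\<^sup>+ y. ennreal (2 * G (s, pt (x + \<tau> * s) y)) \<partial>lborel) \<partial>lborel)" for W \<tau> x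
      have G2: "continuous_on UNIV (\<lambda>w. 2 * G w)" by (intro continuous_intros Gc)
      have J: "(\<integral>\<^sup>+ s\<in>{0..T}. (\<integral>\<^sup>+ x. ennreal (2 * G (s, x)) \<partial>lborel) \<partial>lborel) = 2 * J"
      proof -
        have m1: "(\<lambda>x. ennreal (G (s, x))) \<in> borel_measurable borel" for s
          by (intro borel_measurable_continuous_onI continuous_on_ennreal continuous_on_compose2[OF Gc])
            (auto intro!: continuous_intros)
        have "(\<lambda>w. ennreal (G w)) \<in> borel_measurable borel"
          by (intro borel_measurable_continuous_onI continuous_on_ennreal Gc)
        then have "(\<lambda>(s, x). ennreal (G (s, x))) \<in> borel_measurable (borel \<Otimes>\<^sub>M lborel)"
          by (simp add: borel_prod cong: measurable_cong_sets)
        then have m2: "(\<lambda>s. \<integral>\<^sup>+ x. ennreal (G (s, x)) \<partial>lborel) \<in> borel_measurable borel"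
          by (rule lborel.borel_measurable_nn_integral)
        have "(\<integral>\<^sup>+ x. ennreal (2 * G (s, x)) \<partial>lborel) = 2 * (\<integral>\<^sup>+ x. ennreal (G (s, x)) \<partial>lborel)" for s
        proof -
          have "ennreal (2 * G w) = 2 * ennreal (G w)" for w by (simp add: ennreal_mult G_def)
          then show ?thesis using m1[of s] by (simp add: nn_integral_cmult)
        qed
        moreover have "J = (\<integral>\<^sup>+ s\<in>{0..T}. (\<integral>\<^sup>+ x. ennreal (G (s, x)) \<partial>lborel) \<partial>lborel)"
          by (simp add: J_def G_def)
        ultimately show ?thesis
          using m2 by (simp add: nn_integral_cmult mult.assoc)
      qed
      have mA: "A W \<tau> \<in> borel_measurable borel" and iA: "(\<integral>\<^sup>+ x. A W \<tau> x \<partial>lborel) = (\<integral>\<^sup>+ x. trans_density W 0 x \<partial>lborel) + 2 * J"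
        if "(\<lambda>(t, x). trans_density W t x) \<in> borel_measurable (borel \<Otimes>\<^sub>M borel)" for W \<tau>
      proof -
        have "(\<lambda>x. (0, x)) \<in> borel \<rightarrow>\<^sub>M (borel :: real measure) \<Otimes>\<^sub>M (borel :: real measure)" by simp
        from measurable_compose[OF this that]
        have m: "trans_density W 0 \<in> borel_measurable borel" by simp
        note c = nn_integral_characteristics[OF G2, where T = T and \<tau> = \<tau>]
        show "A W \<tau> \<in> borel_measurable borel"
          unfolding A_def[abs_def] by (intro borel_measurable_add m c(2))
        show "(\<integral>\<^sup>+ x. A W \<tau> x \<partial>lborel) = (\<integral>\<^sup>+ x. trans_density W 0 x \<partial>lborel) + 2 * J"
          unfolding A_def J[symmetric] c(1)[symmetric]
          using m c(2) by (intro nn_integral_add) simp_all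
      qed
      have "?I (U_comp \<Phi>) (V_comp \<Psi>) \<le> (\<integral>\<^sup>+ x. A (U_comp \<Phi>) 1 x * N \<partial>lborel)"
      proof (rule nn_integral_product_le[OF mU mV' mA[OF mU] _ b(1)])
        fix t x assume "t \<in> {0..T}"
        from dirac_transport(1)[OF \<Phi> this] show "trans_density (U_comp \<Phi>) t (x + 1 * t) \<le> A (U_comp \<Phi>) 1 x"
          unfolding A_def G_def .
      qed
      moreover have "?I (V_comp \<Phi>) (U_comp \<Psi>) \<le> (\<integral>\<^sup>+ x. A (V_comp \<Phi>) (- 1) x * N \<partial>lborel)"
      proof (rule nn_integral_product_le[OF mV mU' mA[OF mV] _ b(2)])
        fix t x assume "t \<in> {0..T}"
        from dirac_transport(2)[OF \<Phi> this fin] show "trans_density (V_comp \<Phi>) t (x + (- 1) * t) \<le> A (V_comp \<Phi>) (- 1) x"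
          unfolding A_def G_def .
      qed
      ultimately have "?I (U_comp \<Phi>) (V_comp \<Psi>) + ?I (V_comp \<Phi>) (U_comp \<Psi>)
          \<le> (\<integral>\<^sup>+ x. A (U_comp \<Phi>) 1 x * N \<partial>lborel) + (\<integral>\<^sup>+ x. A (V_comp \<Phi>) (- 1) x * N \<partial>lborel)"
        by (rule add_mono)
      also have "\<dots> = ((\<integral>\<^sup>+ x. trans_density (U_comp \<Phi>) 0 x \<partial>lborel) + 2 * J) * N
          + ((\<integral>\<^sup>+ x. trans_density (V_comp \<Phi>) 0 x \<partial>lborel) + 2 * J) * N"
        using mA[OF mU] mA[OF mV] by (simp add: nn_integral_multc iA[OF mU] iA[OF mV])
      also have "\<dots> = (((\<integral>\<^sup>+ x. trans_density (U_comp \<Phi>) 0 x \<partial>lborel) + (\<integral>\<^sup>+ x. trans_density (V_comp \<Phi>) 0 x \<partial>lborel)) + 4 * J) * N"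
      proof -
        have "2 * J + 2 * J = 4 * J" using distrib_right[of 2 2 J] by simp
        then have "a + 2 * J + (b + 2 * J) = a + b + 4 * J" for a b
          by (metis add.assoc add.commute)
        then show ?thesis by (simp only: distrib_right[symmetric])
      qed
      also have "\<dots> = (2 * L + 4 * J) * N"
        unfolding trans_density_initial(1)[OF \<Phi>] L_def ..
      also have "\<dots> \<le> (4 * L + 4 * J) * N"
        by (intro mult_right_mono add_mono) simp_all
      also have "\<dots> = 4 * N * (L + J)"
        by (simp only: distrib_left[symmetric] mult.assoc mult.commute[of _ N])
      finally show ?thesis .
    qed
  qed
  moreover have "(\<integral>\<^sup>+ t\<in>{0..T}. (\<integral>\<^sup>+ x1.
          (trans_density (U_comp \<Phi>) t x1 * trans_density (V_comp \<Psi>) t x1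
         + trans_density (V_comp \<Phi>) t x1 * trans_density (U_comp \<Psi>) t x1)
         \<partial>lborel) \<partial>lborel) = ?I (U_comp \<Phi>) (V_comp \<Psi>) + ?I (V_comp \<Phi>) (U_comp \<Psi>)"
  proof -
    have slice: "(\<lambda>x. trans_density W t x) \<in> borel_measurable borel"
      if "(\<lambda>(t, x). trans_density W t x) \<in> borel_measurable (borel \<Otimes>\<^sub>M borel)" for W t
    proof -
      have "(\<lambda>x. (t, x)) \<in> borel \<rightarrow>\<^sub>M (borel :: real measure) \<Otimes>\<^sub>M (borel :: real measure)" by simp
      from measurable_compose[OF this that] show ?thesis by simp
    qed
    have int: "(\<lambda>t. \<integral>\<^sup>+ x. trans_density W t x * trans_density W' t x \<partial>lborel) \<in> borel_measurable borel"
      if "(\<lambda>(t, x). trans_density W t x) \<in> borel_measurable (borel \<Otimes>\<^sub>M borel)"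
        "(\<lambda>(t, x). trans_density W' t x) \<in> borel_measurable (borel \<Otimes>\<^sub>M borel)" for W W'
      using that by (intro lborel.borel_measurable_nn_integral) (simp add: case_prod_beta cong: measurable_cong_sets)
    show ?thesis
      using slice[OF mU] slice[OF mV] slice[OF mU'] slice[OF mV'] int[OF mU mV'] int[OF mV mU']
      by (simp add: nn_integral_add distrib_right)
  qed
  ultimately show "(\<integral>\<^sup>+ t\<in>{0..T}. (\<integral>\<^sup>+ x1.
          (trans_density (U_comp \<Phi>) t x1 * trans_density (V_comp \<Psi>) t x1
         + trans_density (V_comp \<Phi>) t x1 * trans_density (U_comp \<Psi>) t x1)
         \<partial>lborel) \<partial>lborel)
      \<le> ennreal 4 * L2_norm_sq (\<Psi> 0) *
          (L2_norm_sq (\<Phi> 0) +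
           (\<integral>\<^sup>+ t\<in>{0..T}. (\<integral>\<^sup>+ x.
              ennreal (norm (D_ym m (V_comp \<Phi> t) x) * norm (U_comp \<Phi> t x))
             \<partial>lborel) \<partial>lborel))"
    by (simp add: L_def N_def J_def)
qed simp

end
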